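(* Let $\mathfrak g$ be a complex simple Lie algebra of type $A_\ell$ with $\ell$ odd, $D_\ell$ ($\ell\ge4$), $E_6$, $E_7$ or $E_8$, of rank $\ell$, with Coxeter number $h$, root system $\Delta$, and with $\beta_i$ ($i\in I=\{1,\dots,\ell\}$), $\sigma$ and $Z$ as in the context. Then for every $i\in I$ the $\sigma$-orbit $Z\cdot\beta_i$ has exactly $h$ elements, and one has the disjoint union $$\Delta=\bigsqcup_{i=1}^{\ell}Z\cdot\beta_i.$$
   Context: Let $\Delta$ be the roots of $\mathfrak g$ with respect to a Cartan subalgebra, $\Delta_+$ a choice of positive roots, $\Pi=\{\alpha_i\mid i\in I\}$ the simple roots, $W$ the Weyl group, $\psi$ the highest root, and $h$ the Coxeter number (so $\ell(h+1)=\dim\mathfrak g$). There is a unique partition $\Pi=\Pi_1\cup\Pi_2$, with $\Pi_k=\{\alpha_i\mid i\in I_k\}$ and $I=I_1\sqcup I_2$, such that distinct roots in the same $\Pi_k$ are orthogonal and all roots in $\Pi_2$ are orthogonal to $\psi$ ($\Pi_2$ may be empty, for $A_1$). Let $s_i\in W$ be the reflection in $\alpha_i$, $\tau_k=\prod_{i\in I_k}s_i$ for $k=1,2$, $\sigma=\tau_2\tau_1$ (a Coxeter element), and $Z\subset W$ the cyclic group generated by $\sigma$. Put $\beta_i=\alpha_i$ if $i\in I_1$ and $\beta_i=-\alpha_i$ if $i\in I_2$. *)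

theory Defs
  imports Complex_Main
begin

locale complex_lie_algebra = vector_space sc
  for sc :: "complex \<Rightarrow> 'g::ab_group_add \<Rightarrow> 'g" +
  fixes br :: "'g \<Rightarrow> 'g \<Rightarrow> 'g"
  assumes finite_dim: "\<exists>B. finite B \<and> span B = UNIV"
    and linear_right: "Vector_Spaces.linear sc sc (\<lambda>y. br x y)"
    and linear_left: "Vector_Spaces.linear sc sc (\<lambda>x. br x y)"
    and alternating: "br x x = 0"
    and jacobi: "br x (br y z) + br y (br z x) + br z (br x y) = 0"

definition lie_ideal ::
    "(complex \<Rightarrow> 'g::ab_group_add \<Rightarrow> 'g) \<Rightarrow> ('g \<Rightarrow> 'g \<Rightarrow> 'g) \<Rightarrow> 'g set \<Rightarrow> bool" where
  "lie_ideal sc br J \<longleftrightarrow> module.subspace sc J \<and> (\<forall>x. \<forall>y\<in>J. br x y \<in> J)"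

definition simple_lie_algebra ::
    "(complex \<Rightarrow> 'g::ab_group_add \<Rightarrow> 'g) \<Rightarrow> ('g \<Rightarrow> 'g \<Rightarrow> 'g) \<Rightarrow> bool" where
  "simple_lie_algebra sc br \<longleftrightarrow> complex_lie_algebra sc br \<and>
     (\<exists>x y. br x y \<noteq> 0) \<and> (\<forall>J. lie_ideal sc br J \<longrightarrow> J = {0} \<or> J = UNIV)"

text \<open>Cartan subalgebras are taken in the form usual for complex semisimple algebras: maximal
  abelian subalgebras all of whose elements are ad-diagonalizable.\<close>

definition cartan_subalgebra ::
    "(complex \<Rightarrow> 'g::ab_group_add \<Rightarrow> 'g) \<Rightarrow> ('g \<Rightarrow> 'g \<Rightarrow> 'g) \<Rightarrow> 'g set \<Rightarrow> bool" where
  "cartan_subalgebra sc br H \<longleftrightarrow> module.subspace sc H \<and>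
     (\<forall>x\<in>H. \<forall>y\<in>H. br x y = 0) \<and>
     (\<forall>x. (\<forall>y\<in>H. br y x = 0) \<longrightarrow> x \<in> H) \<and>
     (\<forall>y\<in>H. module.span sc {x. \<exists>c. br y x = sc c x} = UNIV)"

text \<open>A linear functional on \<open>H\<close> is represented by the function that extends it by zero
  outside \<open>H\<close>; thus distinct functionals are distinct functions.\<close>

definition dual_space :: "(complex \<Rightarrow> 'g::ab_group_add \<Rightarrow> 'g) \<Rightarrow> 'g set \<Rightarrow> ('g \<Rightarrow> complex) set" where
  "dual_space sc H = {f. (\<forall>x\<in>H. \<forall>y\<in>H. f (x + y) = f x + f y) \<and>
     (\<forall>c. \<forall>x\<in>H. f (sc c x) = c * f x) \<and> (\<forall>x. x \<notin> H \<longrightarrow> f x = 0)}"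

definition root_space ::
    "(complex \<Rightarrow> 'g::ab_group_add \<Rightarrow> 'g) \<Rightarrow> ('g \<Rightarrow> 'g \<Rightarrow> 'g) \<Rightarrow> 'g set \<Rightarrow> ('g \<Rightarrow> complex) \<Rightarrow> 'g set" where
  "root_space sc br H f = {x. \<forall>y\<in>H. br y x = sc (f y) x}"

definition lie_roots ::
    "(complex \<Rightarrow> 'g::ab_group_add \<Rightarrow> 'g) \<Rightarrow> ('g \<Rightarrow> 'g \<Rightarrow> 'g) \<Rightarrow> 'g set \<Rightarrow> ('g \<Rightarrow> complex) set" where
  "lie_roots sc br H = {f \<in> dual_space sc H. f \<noteq> (\<lambda>_. 0) \<and> root_space sc br H f \<noteq> {0}}"

text \<open>The coroot of \<open>a\<close> is the unique \<open>h\<close> in \<open>[g_a, g_{-a}]\<close> with \<open>a h = 2\<close>. For a root \<open>b\<close>,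
  the number \<open>b (coroot a)\<close> is the Cartan integer \<open>2 (b, a) / (a, a)\<close>, where \<open>(_, _)\<close> is the
  form induced by the Killing form on the dual of \<open>H\<close>; in particular it vanishes exactly if
  \<open>a\<close> and \<open>b\<close> are orthogonal.\<close>

definition coroot ::
    "(complex \<Rightarrow> 'g::ab_group_add \<Rightarrow> 'g) \<Rightarrow> ('g \<Rightarrow> 'g \<Rightarrow> 'g) \<Rightarrow> 'g set \<Rightarrow> ('g \<Rightarrow> complex) \<Rightarrow> 'g" where
  "coroot sc br H a = (THE h. a h = 2 \<and>
     h \<in> module.span sc {br x y | x y. x \<in> root_space sc br H a \<and> y \<in> root_space sc br H (- a)})"

definition orthogonal_roots ::
    "(complex \<Rightarrow> 'g::ab_group_add \<Rightarrow> 'g) \<Rightarrow> ('g \<Rightarrow> 'g \<Rightarrow> 'g) \<Rightarrow> 'g set \<Rightarrow>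
     ('g \<Rightarrow> complex) \<Rightarrow> ('g \<Rightarrow> complex) \<Rightarrow> bool" where
  "orthogonal_roots sc br H a b \<longleftrightarrow> b (coroot sc br H a) = 0"

definition root_reflection ::
    "(complex \<Rightarrow> 'g::ab_group_add \<Rightarrow> 'g) \<Rightarrow> ('g \<Rightarrow> 'g \<Rightarrow> 'g) \<Rightarrow> 'g set \<Rightarrow>
     ('g \<Rightarrow> complex) \<Rightarrow> ('g \<Rightarrow> complex) \<Rightarrow> ('g \<Rightarrow> complex)" where
  "root_reflection sc br H a f = (\<lambda>x. f x - f (coroot sc br H a) * a x)"

text \<open>The simple roots of a choice of positive roots, numbered by \<open>{1..l}\<close>; the positive roots are
  the roots that are nonnegative integer combinations of the \<open>\<alpha> i\<close>.\<close>

definition simple_roots ::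
    "(complex \<Rightarrow> 'g::ab_group_add \<Rightarrow> 'g) \<Rightarrow> ('g \<Rightarrow> 'g \<Rightarrow> 'g) \<Rightarrow> 'g set \<Rightarrow>
     nat \<Rightarrow> (nat \<Rightarrow> 'g \<Rightarrow> complex) \<Rightarrow> bool" where
  "simple_roots sc br H l \<alpha> \<longleftrightarrow>
     (\<forall>i\<in>{1..l}. \<alpha> i \<in> lie_roots sc br H) \<and>
     (\<forall>c. (\<forall>x. (\<Sum>i = 1..l. c i * \<alpha> i x) = 0) \<longrightarrow> (\<forall>i\<in>{1..l}. c i = 0)) \<and>
     (\<forall>b\<in>lie_roots sc br H. \<exists>n :: nat \<Rightarrow> nat.
        b = (\<lambda>x. \<Sum>i = 1..l. of_nat (n i) * \<alpha> i x) \<or>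
        b = (\<lambda>x. - (\<Sum>i = 1..l. of_nat (n i) * \<alpha> i x)))"

definition highest_root ::
    "(complex \<Rightarrow> 'g::ab_group_add \<Rightarrow> 'g) \<Rightarrow> ('g \<Rightarrow> 'g \<Rightarrow> 'g) \<Rightarrow> 'g set \<Rightarrow>
     nat \<Rightarrow> (nat \<Rightarrow> 'g \<Rightarrow> complex) \<Rightarrow> ('g \<Rightarrow> complex) \<Rightarrow> bool" where
  "highest_root sc br H l \<alpha> \<psi> \<longleftrightarrow> \<psi> \<in> lie_roots sc br H \<and>
     (\<forall>b\<in>lie_roots sc br H. \<exists>n :: nat \<Rightarrow> nat.
        \<forall>x. \<psi> x - b x = (\<Sum>i = 1..l. of_nat (n i) * \<alpha> i x))"

datatype dynkin_type = TypeA nat | TypeD nat | TypeE nat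

fun dynkin_rank :: "dynkin_type \<Rightarrow> nat" where
  "dynkin_rank (TypeA n) = n"
| "dynkin_rank (TypeD n) = n"
| "dynkin_rank (TypeE n) = n"

text \<open>Edges of the Dynkin diagrams, listed from the smaller to the larger vertex, in Bourbaki's
  numbering: \<open>D_n\<close> is the path \<open>1, \<dots>, n-1\<close> with \<open>n\<close> attached to \<open>n-2\<close>, and \<open>E_n\<close> is the path
  \<open>1, 3, 4, \<dots>, n\<close> with \<open>2\<close> attached to \<open>4\<close>.\<close>

fun dynkin_edge :: "dynkin_type \<Rightarrow> nat \<Rightarrow> nat \<Rightarrow> bool" where
  "dynkin_edge (TypeA n) i j \<longleftrightarrow> j = i + 1"
| "dynkin_edge (TypeD n) i j \<longleftrightarrow> (j = i + 1 \<and> j < n) \<or> (i + 2 = n \<and> j = n)"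
| "dynkin_edge (TypeE n) i j \<longleftrightarrow> (i = 1 \<and> j = 3) \<or> (i = 2 \<and> j = 4) \<or> (3 \<le> i \<and> j = i + 1)"

definition cartan_matrix :: "dynkin_type \<Rightarrow> nat \<Rightarrow> nat \<Rightarrow> int" where
  "cartan_matrix X i j =
     (if i = j then 2 else if dynkin_edge X i j \<or> dynkin_edge X j i then - 1 else 0)"

text \<open>The numbering of the simple roots need not be Bourbaki's, hence the permutation \<open>p\<close>.\<close>

definition has_dynkin_type ::
    "(complex \<Rightarrow> 'g::ab_group_add \<Rightarrow> 'g) \<Rightarrow> ('g \<Rightarrow> 'g \<Rightarrow> 'g) \<Rightarrow> 'g set \<Rightarrow>
     nat \<Rightarrow> (nat \<Rightarrow> 'g \<Rightarrow> complex) \<Rightarrow> dynkin_type \<Rightarrow> bool" where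
  "has_dynkin_type sc br H l \<alpha> X \<longleftrightarrow> l = dynkin_rank X \<and>
     (\<exists>p. bij_betw p {1..l} {1..l} \<and>
        (\<forall>i\<in>{1..l}. \<forall>j\<in>{1..l}.
           \<alpha> (p j) (coroot sc br H (\<alpha> (p i))) = of_int (cartan_matrix X i j)))"

definition admissible_partition ::
    "(complex \<Rightarrow> 'g::ab_group_add \<Rightarrow> 'g) \<Rightarrow> ('g \<Rightarrow> 'g \<Rightarrow> 'g) \<Rightarrow> 'g set \<Rightarrow>
     nat \<Rightarrow> (nat \<Rightarrow> 'g \<Rightarrow> complex) \<Rightarrow> ('g \<Rightarrow> complex) \<Rightarrow> nat set \<Rightarrow> nat set \<Rightarrow> bool" where
  "admissible_partition sc br H l \<alpha> \<psi> I1 I2 \<longleftrightarrow>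
     I1 \<union> I2 = {1..l} \<and> I1 \<inter> I2 = {} \<and>
     (\<forall>i\<in>I1. \<forall>j\<in>I1. i \<noteq> j \<longrightarrow> orthogonal_roots sc br H (\<alpha> i) (\<alpha> j)) \<and>
     (\<forall>i\<in>I2. \<forall>j\<in>I2. i \<noteq> j \<longrightarrow> orthogonal_roots sc br H (\<alpha> i) (\<alpha> j)) \<and>
     (\<forall>i\<in>I2. orthogonal_roots sc br H (\<alpha> i) \<psi>)"

text \<open>The product is taken in increasing order of the indices. It is used only for index sets of
  pairwise orthogonal roots, whose reflections commute.\<close>

definition reflection_product ::
    "(complex \<Rightarrow> 'g::ab_group_add \<Rightarrow> 'g) \<Rightarrow> ('g \<Rightarrow> 'g \<Rightarrow> 'g) \<Rightarrow> 'g set \<Rightarrow>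
     (nat \<Rightarrow> 'g \<Rightarrow> complex) \<Rightarrow> nat set \<Rightarrow> ('g \<Rightarrow> complex) \<Rightarrow> ('g \<Rightarrow> complex)" where
  "reflection_product sc br H \<alpha> J =
     foldr (\<circ>) (map (\<lambda>i. root_reflection sc br H (\<alpha> i)) (sorted_list_of_set J)) id"

definition coxeter_element ::
    "(complex \<Rightarrow> 'g::ab_group_add \<Rightarrow> 'g) \<Rightarrow> ('g \<Rightarrow> 'g \<Rightarrow> 'g) \<Rightarrow> 'g set \<Rightarrow>
     (nat \<Rightarrow> 'g \<Rightarrow> complex) \<Rightarrow> nat set \<Rightarrow> nat set \<Rightarrow> ('g \<Rightarrow> complex) \<Rightarrow> ('g \<Rightarrow> complex)" where
  "coxeter_element sc br H \<alpha> I1 I2 =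
     reflection_product sc br H \<alpha> I2 \<circ> reflection_product sc br H \<alpha> I1"

text \<open>The Coxeter number is the order, on the dual of \<open>H\<close>, of a Coxeter element \<open>w\<close>.\<close>

definition coxeter_number ::
    "(complex \<Rightarrow> 'g::ab_group_add \<Rightarrow> 'g) \<Rightarrow> 'g set \<Rightarrow>
     (('g \<Rightarrow> complex) \<Rightarrow> ('g \<Rightarrow> complex)) \<Rightarrow> nat" where
  "coxeter_number sc H w = (LEAST n. 0 < n \<and> (\<forall>f\<in>dual_space sc H. (w ^^ n) f = f))"

definition cyclic_group_gen :: "('b \<Rightarrow> 'b) \<Rightarrow> ('b \<Rightarrow> 'b) set" where
  "cyclic_group_gen w = range (\<lambda>n. w ^^ n) \<union> range (\<lambda>n. inv w ^^ n)"

definition group_orbit :: "('b \<Rightarrow> 'b) set \<Rightarrow> 'b \<Rightarrow> 'b set" where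
  "group_orbit G b = {g b | g. g \<in> G}"

end

theory Submission
  imports Defs
begin

text \<open>Let \<open>m\<close> be the integer for which the adjacency matrix of the Dynkin diagram has a positive
  eigenvector \<open>v\<close> with eigenvalue \<open>2 * cos (pi / m)\<close>. On the plane of \<open>v\<close> the two involutions
  \<open>\<tau>\<^sub>1\<close>, \<open>\<tau>\<^sub>2\<close> act as reflections in lines meeting at the angle \<open>pi / m\<close>, so that \<open>\<sigma>\<close> acts as a
  rotation by \<open>2 * pi / m\<close>. Positive and negative roots project to opposite sectors that do not
  meet. Hence \<open>\<sigma> ^ m\<close> preserves positivity, so it is the identity by the deletion condition, and all
  orbits of roots have \<open>m = h\<close> elements. As the projections of an orbit sum to zero, the orbit
  passes from a positive root to a negative one; there it meets some \<open>\<beta>\<^sub>i\<close>. The \<open>\<beta>\<^sub>i\<close> project to two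
  rays at the angle \<open>pi / m\<close>, hence lie in different orbits.

  The roots are only known to come from a simple Lie algebra. That they are permuted by the simple
  reflections rests on the nondegeneracy of the Killing form, which does not need Cartan's
  criterion here: if all \<open>[g\<^sub>a, g\<^sub>-\<^sub>a]\<close> vanished, the nonzero weight spaces would span an ideal, and
  if \<open>[e, f] \<noteq> 0\<close>, then traces on root strings give \<open>b [e, f] = q * a [e, f]\<close> with real \<open>q\<close>, so
  that \<open>[e, f]\<close> is not isotropic.\<close>

section \<open>Roots of a simple Lie algebra\<close>

context complex_lie_algebra
begin

section \<open>Bracket identities and coordinates in a basis\<close>

lemma br_add_right: "br x (y + z) = br x y + br x z"
  and br_scale_right: "br x (sc c y) = sc c (br x y)"
proof -
  interpret T: Vector_Spaces.linear sc sc "\<lambda>y. br x y" by (rule linear_right)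
  show "br x (y + z) = br x y + br x z" by (rule T.add)
  show "br x (sc c y) = sc c (br x y)" by (rule T.scale)
qed

lemma br_add_left: "br (x + y) z = br x z + br y z"
  and br_scale_left: "br (sc c x) z = sc c (br x z)"
proof -
  interpret T: Vector_Spaces.linear sc sc "\<lambda>x. br x z" by (rule linear_left)
  show "br (x + y) z = br x z + br y z" by (rule T.add)
  show "br (sc c x) z = sc c (br x z)" by (rule T.scale)
qed

lemma br_zero_right [simp]: "br x 0 = 0" and br_zero_left [simp]: "br 0 x = 0"
  using br_scale_right[of x 0 0] br_scale_left[of 0 0 x] by simp_all

lemma br_sum_right: "br x (\<Sum>i\<in>S. g i) = (\<Sum>i\<in>S. br x (g i))"
  by (induction S rule: infinite_finite_induct) (simp_all add: br_add_right)

lemma br_anti: "br x y = - br y x"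
proof -
  have "br (x + y) (x + y) = br x y + br y x"
    unfolding br_add_left br_add_right by (simp add: alternating)
  then show ?thesis by (metis alternating eq_neg_iff_add_eq_0)
qed

lemma br_minus_right: "br x (- y) = - br x y"
  and br_minus_left: "br (- x) y = - br x y"
  using br_scale_right[of x "-1" y] br_scale_left[of "-1" x y] by simp_all

lemma br_diff_right: "br x (y - z) = br x y - br x z"
  using br_add_right[of x y "- z"] by (simp add: br_minus_right)

lemma br_diff_left: "br (x - y) z = br x z - br y z"
  using br_add_left[of x "- y" z] by (simp add: br_minus_left)

lemma br_leibniz: "br x (br y z) = br (br x y) z + br y (br x z)"
proof -
  have "br x (br y z) + br y (- br x z) + - br (br x y) z = 0"
    using jacobi[of x y z] br_anti[of z x] br_anti[of z "br x y"] by simp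
  then show ?thesis by (simp add: br_minus_right algebra_simps eq_neg_iff_add_eq_0)
qed

lemma linear_br: "Vector_Spaces.linear sc sc (br x)"
  using linear_right by simp

lemma linear_br_br: "Vector_Spaces.linear sc sc (\<lambda>z. br x (br y z))"
  using Vector_Spaces.linear_compose[OF linear_br[of y] linear_br[of x]] by (simp add: o_def)

lemma independent_finite: "independent B \<Longrightarrow> finite B"
  using finite_dim independent_span_bound by auto

lemma representation_linear:
  assumes "independent B" "span B = UNIV" "Vector_Spaces.linear sc sc T"
  shows "representation B (T x) b = (\<Sum>b'\<in>B. representation B x b' * representation B (T b') b)"
proof -
  interpret T: Vector_Spaces.linear sc sc T by fact
  have fin: "finite B" using assms(1) by (rule independent_finite)
  have "T x = T (\<Sum>b'\<in>B. sc (representation B x b') b')"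
    using sum_representation_eq[OF assms(1) _ fin, of x] assms(2) by simp
  also have "\<dots> = (\<Sum>b'\<in>B. sc (representation B x b') (T b'))"
    by (simp add: T.sum T.scale)
  finally show ?thesis
    by (simp add: representation_sum representation_scale assms)
qed

lemma representation_eigen:
  assumes "independent B" "span B = UNIV" "Vector_Spaces.linear sc sc T"
    and ev: "\<And>b. b \<in> B \<Longrightarrow> T b = sc (ev b) b"
    and b: "b \<in> B"
  shows "representation B (T x) b = ev b * representation B x b"
proof -
  have fin: "finite B" using assms(1) by (rule independent_finite)
  have "representation B (T b') b = (if b' = b then ev b else 0)" if "b' \<in> B" for b'
    using that assms(1,2) by (simp add: ev representation_scale representation_basis)
  then have "representation B (T x) b
      = (\<Sum>b'\<in>B. if b' = b then representation B x b' * ev b else 0)"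
    by (subst representation_linear[OF assms(1-3)]) (auto intro!: sum.cong)
  then show ?thesis using fin b by (simp add: mult.commute)
qed

lemma representation_eq_0_iff:
  assumes "independent B" "span B = UNIV"
  shows "x = 0 \<longleftrightarrow> (\<forall>b\<in>B. representation B x b = 0)"
proof
  assume "\<forall>b\<in>B. representation B x b = 0"
  then show "x = 0"
    using sum_representation_eq[OF assms(1) _ independent_finite[OF assms(1)], of x] assms(2)
    by simp
qed (simp add: representation_zero)

text \<open>Each \<open>z c\<close> has coordinates only at basis vectors of eigenvalue
  \<open>c\<close>, so at a \<open>b\<close> with \<open>ev b = c\<close> the coordinate of the
  vanishing sum is that of \<open>z c\<close> alone.\<close>

lemma eigenvectors_sum_0:
  assumes B: "independent B" "span B = UNIV"
    and T: "Vector_Spaces.linear sc sc T"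
    and ev: "\<And>b. b \<in> B \<Longrightarrow> T b = sc (ev b) b"
    and C: "finite C" and z: "\<And>c. c \<in> C \<Longrightarrow> T (z c) = sc c (z c)"
    and sum0: "(\<Sum>c\<in>C. z c) = 0" and c: "c \<in> C"
  shows "z c = 0"
proof -
  have off: "representation B (z c') b = 0" if "b \<in> B" "c' \<in> C" "c' \<noteq> ev b" for b c'
    using representation_eigen[OF B T ev that(1), of "z c'"] z[OF that(2)] that B
    by (simp add: representation_scale)
  have "representation B (z c) b = 0" if b: "b \<in> B" for b
  proof (cases "c = ev b")
    case True
    have "0 = (\<Sum>c'\<in>C. representation B (z c') b)"
      using sum0 B by (metis representation_sum UNIV_I representation_zero)
    also have "\<dots> = representation B (z c) b"
      using C c by (subst sum.remove[of _ c]) (auto intro!: sum.neutral off[OF b] simp: True)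
    finally show ?thesis by simp
  qed (use off b c in auto)
  then show ?thesis using B by (simp add: representation_eq_0_iff)
qed

section \<open>Simultaneous diagonalization under a Cartan subalgebra\<close>

text \<open>Commuting maps preserve each other's eigenspaces: the components of a common eigenvector
  of \<open>F\<close> in the eigenspaces of \<open>br y\<close> remain eigenvectors for
  \<open>F\<close>, with the eigenvalues of the original vector.\<close>

lemma span_common_eigenvectors_insert:
  assumes diag: "span {x. \<exists>c. br y x = sc c x} = UNIV"
    and comm: "\<And>y' x. y' \<in> F \<Longrightarrow> br y (br y' x) = br y' (br y x)"
    and F: "span {x. \<forall>y'\<in>F. \<exists>c. br y' x = sc c x} = UNIV"
  shows "span {x. \<forall>y'\<in>insert y F. \<exists>c. br y' x = sc c x} = UNIV"
proof -
  obtain B where sub: "B \<subseteq> {x. \<exists>c. br y x = sc c x}" and ind: "independent B"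
    and sup: "{x. \<exists>c. br y x = sc c x} \<subseteq> span B"
    by (rule maximal_independent_subset)
  have sp: "span B = UNIV"
    using span_minimal[OF sup subspace_span] diag by auto
  from sub have "\<forall>b\<in>B. \<exists>c. br y b = sc c b" by blast
  then obtain ev where ev: "\<And>b. b \<in> B \<Longrightarrow> br y b = sc (ev b) b" by metis
  have fin: "finite B" using ind by (rule independent_finite)
  have "x \<in> span {x. \<forall>y'\<in>insert y F. \<exists>c. br y' x = sc c x}"
    if x: "\<forall>y'\<in>F. \<exists>c. br y' x = sc c x" for x
  proof -
    define X where "X c = (\<Sum>b\<in>{b\<in>B. ev b = c}. sc (representation B x b) b)" for c
    have xX: "x = (\<Sum>c\<in>ev ` B. X c)"
    proof -
      have "x = (\<Sum>b\<in>B. sc (representation B x b) b)"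
        using sum_representation_eq[OF ind _ fin, of x] sp by simp
      also have "\<dots> = (\<Sum>c\<in>ev ` B. X c)" unfolding X_def
        by (rule sum.image_gen) (rule fin)
      finally show ?thesis .
    qed
    have yX: "br y (X c) = sc c (X c)" for c
      unfolding X_def br_sum_right scale_sum_right
      by (rule sum.cong) (auto simp: br_scale_right ev mult.commute)
    have "\<exists>c'. br y' (X c) = sc c' (X c)" if c: "c \<in> ev ` B" and y': "y' \<in> F" for c y'
    proof -
      obtain c' where c': "br y' x = sc c' x" using x y' by blast
      \<comment> \<open>These differences lie in different eigenspaces of \<open>br y\<close> and
        sum to \<open>br y' x - sc c' x = 0\<close>, so each of them vanishes.\<close>
      have "br y' (X c) - sc c' (X c) = 0"
      proof (rule eigenvectors_sum_0[where z = "\<lambda>c. br y' (X c) - sc c' (X c)",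
            OF ind sp linear_br[of y] ev _ _ _ c])
        show "br y (br y' (X d) - sc c' (X d)) = sc d (br y' (X d) - sc c' (X d))" for d
          by (simp add: br_diff_right comm[OF y'] yX br_scale_right scale_right_diff_distrib
              mult.commute)
        show "(\<Sum>d\<in>ev ` B. br y' (X d) - sc c' (X d)) = 0"
          using c' by (simp add: sum_subtractf flip: br_sum_right scale_sum_right xX)
      qed (use fin in auto)
      then show ?thesis by auto
    qed
    then have "X c \<in> span {x. \<forall>y'\<in>insert y F. \<exists>c. br y' x = sc c x}" if "c \<in> ev ` B" for c
      using that yX[of c] by (intro span_base) auto
    then show ?thesis by (subst xX) (rule span_sum)
  qed
  then have "span {x. \<forall>y'\<in>F. \<exists>c. br y' x = sc c x}
      \<subseteq> span {x. \<forall>y'\<in>insert y F. \<exists>c. br y' x = sc c x}"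
    by (intro span_minimal) auto
  then show ?thesis using F by auto
qed

lemma span_common_eigenvectors:
  assumes "finite F" "F \<subseteq> H" and H: "cartan_subalgebra sc br H"
  shows "span {x. \<forall>y\<in>F. \<exists>c. br y x = sc c x} = UNIV"
  using assms(1,2)
proof (induction F rule: finite_induct)
  case (insert y F)
  have y: "y \<in> H" and F: "F \<subseteq> H" using insert.prems by auto
  show ?case
  proof (rule span_common_eigenvectors_insert)
    show "span {x. \<exists>c. br y x = sc c x} = UNIV"
      using H y unfolding cartan_subalgebra_def by blast
    show "br y (br y' x) = br y' (br y x)" if "y' \<in> F" for y' x
    proof -
      have "br y y' = 0" using H y F that unfolding cartan_subalgebra_def by blast
      then show ?thesis using br_leibniz[of y y' x] by simp
    qed
    show "span {x. \<forall>y'\<in>F. \<exists>c. br y' x = sc c x} = UNIV" using insert.IH F by blast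
  qed
qed simp

text \<open>A finite basis \<open>F\<close> of \<open>H\<close> suffices: an eigenvector of all of
  \<open>F\<close> is one of all of \<open>H\<close>, and if it is nonzero, its eigenvalue depends
  linearly on the element of \<open>H\<close>.\<close>

lemma span_weight_vectors:
  assumes H: "cartan_subalgebra sc br H"
  shows "span {x. \<exists>f\<in>dual_space sc H. x \<in> root_space sc br H f} = UNIV"
proof -
  obtain F where F: "F \<subseteq> H" "independent F" "H \<subseteq> span F"
    by (rule maximal_independent_subset)
  have sub: "subspace H" using H by (simp add: cartan_subalgebra_def)
  have "\<exists>f\<in>dual_space sc H. x \<in> root_space sc br H f"
    if x: "\<forall>y\<in>F. \<exists>c. br y x = sc c x" for x
  proof (cases "x = 0")
    case True
    then show ?thesis
      by (intro bexI[of _ "\<lambda>_. 0"]) (auto simp: root_space_def dual_space_def)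
  next
    case False
    have "\<exists>c. br y x = sc c x" if "y \<in> span F" for y
      using that
    proof (induction y rule: span_induct_alt)
      case base
      then show ?case by (intro exI[of _ 0]) simp
    next
      case (step c z y)
      then obtain c1 c2 where "br z x = sc c1 x" "br y x = sc c2 x" using x by blast
      then show ?case
        by (intro exI[of _ "c * c1 + c2"])
          (simp add: br_add_left br_scale_left scale_left_distrib)
    qed
    then obtain g where g: "\<And>y. y \<in> H \<Longrightarrow> br y x = sc (g y) x" using F(3) by (metis subsetD)
    \<comment> \<open>The extension by zero is the normal form that \<open>dual_space\<close>
      demands.\<close>
    define f where "f y = (if y \<in> H then g y else 0)" for y
    have "f (y + z) = f y + f z" if "y \<in> H" "z \<in> H" for y z
    proof -
      have "y + z \<in> H" using that sub by (rule_tac subspace_add)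
      then have "sc (g (y + z)) x = sc (g y + g z) x"
        using that by (simp add: br_add_left scale_left_distrib flip: g)
      then show ?thesis using False that \<open>y + z \<in> H\<close> by (simp add: f_def)
    qed
    moreover have "f (sc c y) = c * f y" if "y \<in> H" for c y
    proof -
      have "sc c y \<in> H" using that sub by (rule_tac subspace_scale)
      then have "sc (g (sc c y)) x = sc (c * g y) x"
        using that by (metis br_scale_left scale_scale g)
      then show ?thesis using False that \<open>sc c y \<in> H\<close> by (simp add: f_def)
    qed
    ultimately have "f \<in> dual_space sc H" by (auto simp: dual_space_def f_def)
    moreover have "x \<in> root_space sc br H f" using g by (auto simp: root_space_def f_def)
    ultimately show ?thesis by blast
  qed
  then have "{x. \<forall>y\<in>F. \<exists>c. br y x = sc c x}
      \<subseteq> {x. \<exists>f\<in>dual_space sc H. x \<in> root_space sc br H f}" by blast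
  from span_mono[OF this] show ?thesis
    using span_common_eigenvectors[OF independent_finite[OF F(2)] F(1) H] by auto
qed

lemma weight_basis_exists:
  assumes H: "cartan_subalgebra sc br H"
  obtains B wt where "independent B" "span B = UNIV"
    "\<forall>b\<in>B. wt b \<in> dual_space sc H \<and> b \<in> root_space sc br H (wt b)"
proof -
  let ?W = "{x. \<exists>f\<in>dual_space sc H. x \<in> root_space sc br H f}"
  obtain B where B: "B \<subseteq> ?W" "independent B" "?W \<subseteq> span B"
    by (rule maximal_independent_subset)
  have "span B = UNIV"
    using span_minimal[OF B(3) subspace_span] span_weight_vectors[OF H] by auto
  moreover from B(1) have "\<forall>b\<in>B. \<exists>f. f \<in> dual_space sc H \<and> b \<in> root_space sc br H f"
    by blast
  then obtain wt where
    "\<forall>b\<in>B. wt b \<in> dual_space sc H \<and> b \<in> root_space sc br H (wt b)" by metis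
  ultimately show ?thesis using that B(2) by blast
qed

end

section \<open>Weight vectors and traces\<close>

text \<open>A basis of weight vectors takes the place of a root space decomposition: coordinates in
  it detect weights, and traces become finite sums over \<open>B\<close>.\<close>

locale simple_weight_basis = complex_lie_algebra +
  fixes H B :: "'a set" and wt :: "'a \<Rightarrow> 'a \<Rightarrow> complex"
  assumes simple: "simple_lie_algebra sc br"
    and cartan: "cartan_subalgebra sc br H"
    and ind: "independent B" and span_B: "span B = UNIV"
    and wt_dual: "b \<in> B \<Longrightarrow> wt b \<in> dual_space sc H"
    and wt_space: "b \<in> B \<Longrightarrow> b \<in> root_space sc br H (wt b)"
begin

abbreviation "\<g> \<equiv> root_space sc br H"
abbreviation "rep \<equiv> representation B"

lemma subspace_H: "subspace H"
  using cartan by (simp add: cartan_subalgebra_def)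

lemma br_H_H: "x \<in> H \<Longrightarrow> y \<in> H \<Longrightarrow> br x y = 0"
  using cartan unfolding cartan_subalgebra_def by blast

lemma in_H: "(\<And>y. y \<in> H \<Longrightarrow> br y x = 0) \<Longrightarrow> x \<in> H"
  using cartan unfolding cartan_subalgebra_def by blast

lemma not_abelian: "\<exists>x y. br x y \<noteq> 0"
  using simple unfolding simple_lie_algebra_def by blast

lemma ideal_trivial: "lie_ideal sc br J \<Longrightarrow> J = {0} \<or> J = UNIV"
  using simple unfolding simple_lie_algebra_def by blast

lemma finite_B: "finite B"
  using ind by (rule independent_finite)

lemma root_spaceD: "x \<in> \<g> f \<Longrightarrow> y \<in> H \<Longrightarrow> br y x = sc (f y) x"
  by (simp add: root_space_def)

lemma root_space_cong: "(\<And>y. y \<in> H \<Longrightarrow> f y = g y) \<Longrightarrow> \<g> f = \<g> g"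
  by (auto simp: root_space_def)

lemma subspace_root_space: "subspace (\<g> f)"
  by (auto simp: root_space_def subspace_def br_add_right br_scale_right scale_right_distrib mult.commute)

lemma br_root_space:
  assumes "x \<in> \<g> f" "z \<in> \<g> g" and "\<And>y. y \<in> H \<Longrightarrow> k y = f y + g y"
  shows "br x z \<in> \<g> k"
  using assms
  by (simp add: root_space_def br_leibniz[of _ x z] br_scale_left br_scale_right scale_left_distrib)

lemma root_space_zero_H: "x \<in> \<g> f \<Longrightarrow> (\<And>y. y \<in> H \<Longrightarrow> f y = 0) \<Longrightarrow> x \<in> H"
  by (rule in_H) (simp add: root_spaceD)

lemma br_opposite_H: "x \<in> \<g> a \<Longrightarrow> z \<in> \<g> (- a) \<Longrightarrow> br x z \<in> H"
  by (rule root_space_zero_H[OF br_root_space[where k = "\<lambda>_. 0"]]) auto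

lemma br_H_B: "b \<in> B \<Longrightarrow> y \<in> H \<Longrightarrow> br y b = sc (wt b y) b"
  using wt_space by (rule root_spaceD)

lemma rep_br_H: "b \<in> B \<Longrightarrow> y \<in> H \<Longrightarrow> rep (br y x) b = wt b y * rep x b"
  by (rule representation_eigen[OF ind span_B linear_br br_H_B])

lemma rep_add: "rep (x + y) b = rep x b + rep y b"
  and rep_diff: "rep (x - y) b = rep x b - rep y b"
  and rep_scale: "rep (sc c x) b = c * rep x b"
  using ind span_B by (simp_all add: representation_add representation_diff representation_scale)

lemma rep_weight: "x \<in> \<g> f \<Longrightarrow> b \<in> B \<Longrightarrow> rep x b \<noteq> 0 \<Longrightarrow> y \<in> H \<Longrightarrow> wt b y = f y"
  using rep_br_H[of b y x] root_spaceD[of x f y] by (simp add: rep_scale)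

lemma eq_0_iff_rep: "x = 0 \<longleftrightarrow> (\<forall>b\<in>B. rep x b = 0)"
  using ind span_B by (rule representation_eq_0_iff)

lemma weight_occurs:
  assumes "x \<in> \<g> f" "x \<noteq> 0"
  obtains b where "b \<in> B" "\<And>y. y \<in> H \<Longrightarrow> wt b y = f y"
  using assms eq_0_iff_rep[of x] rep_weight by blast

text \<open>Every term of the two double sums contains an entry of \<open>F\<close>, so it is enough
  that \<open>F\<close> alone respects \<open>S\<close> and its complement. With
  \<open>S = B\<close> this is the usual cyclicity of the trace.\<close>

lemma trace_comm:
  assumes E: "Vector_Spaces.linear sc sc E" and F: "Vector_Spaces.linear sc sc F" and S: "S \<subseteq> B"
    and ES: "\<And>b b'. b \<in> B \<Longrightarrow> b' \<in> B \<Longrightarrow> rep (F b) b' \<noteq> 0 \<Longrightarrow> b \<in> S \<longleftrightarrow> b' \<in> S"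
  shows "(\<Sum>b\<in>S. rep (E (F b)) b) = (\<Sum>b\<in>S. rep (F (E b)) b)"
proof -
  have "rep (E (F b)) b = (\<Sum>b'\<in>S. rep (F b) b' * rep (E b') b)" if "b \<in> S" for b
    unfolding representation_linear[OF ind span_B E, of "F b"]
    using S ES[of b] that finite_B by (intro sum.mono_neutral_right) auto
  moreover have "rep (F (E b)) b = (\<Sum>b'\<in>S. rep (E b) b' * rep (F b') b)" if "b \<in> S" for b
    unfolding representation_linear[OF ind span_B F, of "E b"]
    using S ES[of _ b] that finite_B by (intro sum.mono_neutral_right) auto
  ultimately show ?thesis
    using sum.swap[of "\<lambda>b b'. rep (F b) b' * rep (E b') b" S S] by (simp add: mult.commute)
qed

text \<open>The trace of \<open>[e, f]\<close> on the sum of the weight spaces of a string vanishes.\<close>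

lemma weight_on_bracket:
  assumes b0: "b0 \<in> B"
  shows "\<exists>q::real. \<forall>e\<in>\<g> a. \<forall>f\<in>\<g> (- a). wt b0 (br e f) = q * a (br e f)"
proof -
  define S where "S = {b \<in> B. \<exists>k::int. \<forall>y\<in>H. wt b y = wt b0 y + k * a y}"
  have "\<forall>b\<in>S. \<exists>k::int. \<forall>y\<in>H. wt b y = wt b0 y + k * a y" by (simp add: S_def)
  then obtain k :: "'a \<Rightarrow> int" where k: "\<And>b y. b \<in> S \<Longrightarrow> y \<in> H \<Longrightarrow> wt b y = wt b0 y + k b * a y"
    by metis
  have S: "finite S" "b0 \<in> S" "S \<subseteq> B"
    using finite_B b0 by (auto simp: S_def intro!: exI[of _ 0])
  then have card: "card S \<noteq> 0" by auto
  \<comment> \<open>The factor is minus the mean of the shifts along the string. It is real because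
    the shifts are integers, and it does not involve \<open>e\<close> and \<open>f\<close>.\<close>
  have "wt b0 (br e f) = of_real (- (\<Sum>b\<in>S. k b) / card S) * a (br e f)"
    if e: "e \<in> \<g> a" and f: "f \<in> \<g> (- a)" for e f
  proof -
    have h: "br e f \<in> H" using e f by (rule br_opposite_H)
    \<comment> \<open>\<open>br f\<close> lowers weights by \<open>a\<close>, and \<open>S\<close>
      admits shifts by all integers, so neither \<open>S\<close> nor its complement can be
      left.\<close>
    have shift: "b \<in> S \<longleftrightarrow> b' \<in> S" if "b \<in> B" "b' \<in> B" "rep (br f b) b' \<noteq> 0" for b b'
    proof -
      have eq: "wt b' y = wt b y - a y" if "y \<in> H" for y
        using rep_weight[OF br_root_space[OF f wt_space[OF \<open>b \<in> B\<close>], of "\<lambda>y. wt b y - a y"]]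
          \<open>b' \<in> B\<close> \<open>rep (br f b) b' \<noteq> 0\<close> that by auto
      show ?thesis
      proof
        assume "b \<in> S"
        then show "b' \<in> S" using \<open>b' \<in> B\<close> k[of b] unfolding S_def
          by (auto simp: eq algebra_simps intro!: exI[of _ "k b - 1"])
      next
        assume "b' \<in> S"
        then have "wt b y = wt b0 y + of_int (k b' + 1) * a y" if "y \<in> H" for y
          using k[of b' y] eq[of y] that by (simp add: algebra_simps)
        then show "b \<in> S" using \<open>b \<in> B\<close> unfolding S_def by blast
      qed
    qed
    have "0 = (\<Sum>b\<in>S. rep (br e (br f b)) b) - (\<Sum>b\<in>S. rep (br f (br e b)) b)"
      using trace_comm[OF linear_br linear_br S(3) shift] by simp
    also have "\<dots> = (\<Sum>b\<in>S. rep (br (br e f) b) b)"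
      by (simp add: br_leibniz[of e f] rep_add flip: sum_subtractf)
    also have "\<dots> = (\<Sum>b\<in>S. wt b (br e f))"
      using S h ind by (intro sum.cong) (auto simp: rep_br_H representation_basis)
    also have "\<dots> = card S * wt b0 (br e f) + (\<Sum>b\<in>S. k b) * a (br e f)"
      using h by (simp add: k sum.distrib sum_distrib_right)
    finally show ?thesis using card by (simp add: field_simps eq_neg_iff_add_eq_0)
  qed
  then show ?thesis by blast
qed

text \<open>The centre is an ideal, and it is not the whole algebra because some bracket is
  nonzero.\<close>

lemma central_eq_0:
  assumes "\<And>x. br z x = 0"
  shows "z = 0"
proof -
  have "lie_ideal sc br {z. \<forall>x. br z x = 0}"
    unfolding lie_ideal_def
  proof (intro conjI allI ballI)
    show "subspace {z. \<forall>x. br z x = 0}" by (simp add: subspace_def br_add_left br_scale_left)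
    show "br x y \<in> {z. \<forall>x. br z x = 0}" if "y \<in> {z. \<forall>x. br z x = 0}" for x y
      using that by (simp add: br_anti[of x y] br_minus_left)
  qed
  then show ?thesis using ideal_trivial assms not_abelian by blast
qed

text \<open>An element of \<open>H\<close> on which all weights vanish acts as zero on the basis,
  hence is central.\<close>

lemma H_eq_0:
  assumes "h \<in> H" "\<And>b. b \<in> B \<Longrightarrow> wt b h = 0"
  shows "h = 0"
proof (rule central_eq_0)
  show "br h x = 0" for x
    using assms by (simp add: eq_0_iff_rep rep_br_H)
qed

text \<open>By \<open>weight_on_bracket\<close> the value of every weight on \<open>br e f\<close>
  is a multiple of \<open>a (br e f)\<close>.\<close>

lemma bracket_eq_0:
  assumes "e \<in> \<g> a" "f \<in> \<g> (- a)" "a (br e f) = 0"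
  shows "br e f = 0"
  using H_eq_0[OF br_opposite_H[OF assms(1,2)]] weight_on_bracket[of _ a] assms by fastforce

section \<open>The Killing form and its nondegeneracy\<close>

text \<open>The Killing form, as the trace of \<open>br x\<close> after \<open>br y\<close> in the
  weight basis.\<close>

definition \<kappa> :: "'a \<Rightarrow> 'a \<Rightarrow> complex" where
  "\<kappa> x y = (\<Sum>b\<in>B. rep (br x (br y b)) b)"

lemma \<kappa>_add_left: "\<kappa> (x + y) z = \<kappa> x z + \<kappa> y z"
  and \<kappa>_scale_left: "\<kappa> (sc c x) z = c * \<kappa> x z"
  by (simp_all add: \<kappa>_def br_add_left br_scale_left rep_add rep_scale sum.distrib sum_distrib_left)

lemma \<kappa>_zero_left [simp]: "\<kappa> 0 z = 0"
  using \<kappa>_scale_left[of 0 0 z] by simp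

lemma \<kappa>_minus_left: "\<kappa> (- x) z = - \<kappa> x z"
  using \<kappa>_scale_left[of "-1" x z] by simp

lemma \<kappa>_sym: "\<kappa> x y = \<kappa> y x"
  unfolding \<kappa>_def by (rule trace_comm) (auto simp: linear_br)

text \<open>Once the inner brackets are expanded, both sides contain the trace of the composition in
  the order x, y, z; the remaining traces, in the orders y, x, z and x, z, y, agree by
  cyclicity.\<close>

lemma \<kappa>_invariant: "\<kappa> (br x y) z = \<kappa> x (br y z)"
proof -
  have "(\<Sum>b\<in>B. rep (br y (br x (br z b))) b) = (\<Sum>b\<in>B. rep (br x (br z (br y b))) b)"
    by (rule trace_comm[of "br y" "\<lambda>b. br x (br z b)"]) (auto simp: linear_br linear_br_br)
  moreover have "br (br x y) w = br x (br y w) - br y (br x w)" for x y w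
    by (simp add: br_leibniz[of x y w])
  ultimately show ?thesis
    by (simp add: \<kappa>_def br_diff_right rep_diff sum_subtractf)
qed

text \<open>On \<open>br e f\<close> all weights are real multiples of the single number
  \<open>wt b0 (br e f)\<close>, so the form at this element is the square of that number times a
  sum of real squares, one of which belongs to \<open>b0\<close> itself.\<close>

lemma bracket_eq_0_if_\<kappa>_eq_0:
  assumes \<kappa>: "\<And>x y. \<kappa> x y = 0" and b0: "b0 \<in> B"
    and e: "e \<in> \<g> (wt b0)" and f: "f \<in> \<g> (- wt b0)"
  shows "br e f = 0"
proof (rule bracket_eq_0[OF e f], rule ccontr)
  let ?h = "br e f"
  assume nz: "wt b0 ?h \<noteq> 0"
  have h: "?h \<in> H" using e f by (rule br_opposite_H)
  obtain q :: "'a \<Rightarrow> real" where q: "\<And>b. b \<in> B \<Longrightarrow> wt b ?h = q b * wt b0 ?h"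
    using weight_on_bracket[of _ "wt b0"] e f by metis
  have "0 = \<kappa> ?h ?h" using \<kappa> by simp
  also have "\<dots> = (\<Sum>b\<in>B. (q b * wt b0 ?h)\<^sup>2)"
    unfolding \<kappa>_def using h ind
    by (intro sum.cong)
      (auto simp: rep_br_H representation_basis power2_eq_square simp flip: q)
  also have "\<dots> = of_real (\<Sum>b\<in>B. (q b)\<^sup>2) * (wt b0 ?h)\<^sup>2"
    by (simp add: power_mult_distrib sum_distrib_right)
  finally have "(\<Sum>b\<in>B. (q b)\<^sup>2) = 0" using nz by (metis mult_eq_0_iff of_real_eq_0_iff power_not_zero)
  then have "q b0 = 0" using b0 finite_B by (simp add: sum_nonneg_eq_0_iff)
  then show False using q[OF b0] nz by simp
qed

text \<open>With a vanishing form the basis vectors of nonzero weight would span an ideal. If it is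
  zero, the algebra equals \<open>H\<close> and is abelian; if it is everything, \<open>H\<close> is
  zero and no nonzero weight is left.\<close>

lemma \<kappa>_not_0: "\<exists>x y. \<kappa> x y \<noteq> 0"
proof (rule ccontr)
  assume "\<not> ?thesis"
  then have zero: "br e f = 0" if "b0 \<in> B" "e \<in> \<g> (wt b0)" "f \<in> \<g> (- wt b0)" for b0 e f
    using bracket_eq_0_if_\<kappa>_eq_0 that by blast
  define B' where "B' = {b \<in> B. \<exists>y\<in>H. wt b y \<noteq> 0}"
  have B': "br b' b \<in> span B'" if b: "b \<in> B'" and b': "b' \<in> B" for b b'
  proof (cases "\<exists>y\<in>H. wt b' y + wt b y \<noteq> 0")
    case True
    have "br b' b = (\<Sum>c\<in>B. sc (rep (br b' b) c) c)"
      using sum_representation_eq[OF ind _ finite_B] span_B by simp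
    also have "\<dots> \<in> span B'"
    proof (intro span_sum)
      fix c assume c: "c \<in> B"
      show "sc (rep (br b' b) c) c \<in> span B'"
      proof (cases "rep (br b' b) c = 0")
        case False
        have "br b' b \<in> \<g> (\<lambda>y. wt b' y + wt b y)"
          using b b' by (intro br_root_space[OF wt_space wt_space]) (auto simp: B'_def)
        from rep_weight[OF this c False] True have "c \<in> B'" using c by (auto simp: B'_def)
        then show ?thesis by (intro span_scale span_base)
      qed (simp add: span_zero)
    qed
    finally show ?thesis .
  next
    case False
    \<comment> \<open>For opposite weights the bracket lies in \<open>H\<close> and need not be
      reached from \<open>B'\<close>; here the assumed vanishing of the form enters.\<close>
    then have "\<g> (wt b') = \<g> (- wt b)" by (intro root_space_cong) (auto simp: eq_neg_iff_add_eq_0)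
    then have "br b b' = 0" using b b' wt_space[of b'] wt_space[of b] zero[of b b b'] by (auto simp: B'_def)
    then show ?thesis using br_anti[of b' b] by (simp add: span_zero)
  qed
  have step: "br x b \<in> span B'" if b: "b \<in> B'" for x b
  proof -
    have "x \<in> span B" using span_B by simp
    then show ?thesis
    proof (induction x rule: span_induct_alt)
      case (step c z y)
      then show ?case using B'[OF b] by (auto simp: br_add_left br_scale_left intro!: span_add span_scale)
    qed (simp add: span_zero)
  qed
  have "br x y \<in> span B'" if "y \<in> span B'" for x y
    using that
  proof (induction y rule: span_induct_alt)
    case (step c z y)
    then show ?case
      using \<open>\<And>x b. b \<in> B' \<Longrightarrow> br x b \<in> span B'\<close>
      by (auto simp: br_add_right br_scale_right intro!: span_add span_scale)
  qed (simp add: span_zero)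
  then have "lie_ideal sc br (span B')" by (simp add: lie_ideal_def)
  then consider "span B' = {0}" | "span B' = UNIV" using ideal_trivial by blast
  then show False
  proof cases
    case 1
    have "b \<in> H" if b: "b \<in> B" for b
    proof -
      have "b \<noteq> 0" using b ind dependent_zero by blast
      then have "b \<notin> B'" using 1 span_base by fastforce
      then show ?thesis using b by (intro root_space_zero_H[OF wt_space]) (auto simp: B'_def)
    qed
    then have "span B \<subseteq> H" using subspace_H by (intro span_minimal) auto
    then show False using span_B not_abelian br_H_H by blast
  next
    case 2
    have BB: "B \<subseteq> B'"
    proof
      fix b assume b: "b \<in> B"
      show "b \<in> B'"
      proof (rule ccontr)
        assume "b \<notin> B'"
        then have "span B' \<subseteq> span (B - {b})" by (intro span_mono) (auto simp: B'_def)
        then show False using 2 b ind by (auto simp: dependent_def)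
      qed
    qed
    have "h = 0" if "h \<in> H" for h
    proof (rule H_eq_0[OF that])
      fix b assume b: "b \<in> B"
      show "wt b h = 0"
      proof (rule ccontr)
        assume "wt b h \<noteq> 0"
        then have "h \<noteq> 0" using wt_dual[OF b] that by (force simp: dual_space_def)
        then obtain c where c: "c \<in> B" "rep h c \<noteq> 0" using eq_0_iff_rep by blast
        \<comment> \<open>An element of weight zero has coordinates only at basis vectors of weight
          zero, and there are none in \<open>B'\<close>.\<close>
        have "h \<in> \<g> (\<lambda>_. 0)" using that br_H_H by (simp add: root_space_def)
        from rep_weight[OF this c] show False using BB c(1) by (auto simp: B'_def)
      qed
    qed
    then have "wt b y = 0" if "b \<in> B" "y \<in> H" for b y
      using wt_dual[OF that(1)] that(2) unfolding dual_space_def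
      by (smt (verit) add_cancel_right_left mem_Collect_eq add_0)
    then have "B = {}" using BB by (auto simp: B'_def)
    then show False using span_B not_abelian by auto
  qed
qed

text \<open>The radical of an invariant form is an ideal, and it is proper because the form is
  nonzero.\<close>

lemma \<kappa>_nondegenerate:
  assumes "\<And>y. \<kappa> x y = 0"
  shows "x = 0"
proof -
  have "lie_ideal sc br {x. \<forall>y. \<kappa> x y = 0}"
    unfolding lie_ideal_def
  proof (intro conjI allI ballI)
    show "subspace {x. \<forall>y. \<kappa> x y = 0}" by (simp add: subspace_def \<kappa>_add_left \<kappa>_scale_left)
    show "br x y \<in> {x. \<forall>y. \<kappa> x y = 0}" if "y \<in> {x. \<forall>y. \<kappa> x y = 0}" for x y
      using that by (simp add: br_anti[of x y] \<kappa>_minus_left \<kappa>_invariant)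
  qed
  then show ?thesis using ideal_trivial \<kappa>_not_0 assms by blast
qed

end

section \<open>Strings of vectors under an sl2-triple\<close>

context complex_lie_algebra
begin

lemma funpow_weight:
  assumes he: "br h e = sc d e" and hw: "br h w = sc m w"
  shows "br h ((br e ^^ k) w) = sc (m + of_nat k * d) ((br e ^^ k) w)"
proof (induction k)
  case (Suc k)
  then show ?case
    by (simp add: br_leibniz[of h e] he br_scale_left br_scale_right algebra_simps
        flip: scale_left_distrib)
qed (use hw in simp)

text \<open>By \<open>chain\<close>, \<open>br f\<close> takes \<open>(br e ^^ Suc k) w\<close> to
  \<open>- (k + 1) * (m + k)\<close> times its predecessor. This factor is nonzero for
  \<open>m > 0\<close>, so the nilpotency of \<open>br e\<close> on \<open>w\<close> descends step
  by step to \<open>w = 0\<close>.\<close>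

lemma sl2_positive_weight_eq_0:
  assumes ef: "br e f = h" and he: "br h e = sc 2 e"
    and hw: "br h w = sc (of_real m) w" and m: "m > 0" and efw: "br e (br f w) = 0"
    and nil: "\<exists>k. (br e ^^ k) w = 0"
  shows "w = 0"
proof -
  have fe: "br f (br e u) = br e (br f u) - br h u" for u
    by (simp add: br_leibniz[of e f u] ef)
  have chain: "br f ((br e ^^ Suc k) w) = sc (- (of_nat (Suc k) * (of_real m + of_nat k))) ((br e ^^ k) w)"
    for k
  proof (induction k)
    case 0
    then show ?case using fe[of w] efw hw by simp
  next
    case (Suc k)
    have "br f ((br e ^^ Suc (Suc k)) w)
        = br e (br f ((br e ^^ Suc k) w)) - br h ((br e ^^ Suc k) w)"
      using fe[of "(br e ^^ Suc k) w"] by simp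
    also have "\<dots> = sc (- (of_nat (Suc k) * (of_real m + of_nat k))) ((br e ^^ Suc k) w)
        - sc (of_real m + of_nat (Suc k) * 2) ((br e ^^ Suc k) w)"
      unfolding Suc funpow_weight[OF he hw] by (simp only: br_scale_right funpow.simps o_apply)
    also have "\<dots> = sc (- (of_nat (Suc (Suc k)) * (of_real m + of_nat (Suc k)))) ((br e ^^ Suc k) w)"
      by (simp only: flip: scale_left_diff_distrib) (simp add: algebra_simps)
    finally show ?case .
  qed
  have "(br e ^^ k) w = 0" if "(br e ^^ Suc k) w = 0" for k
  proof -
    have "of_real m + (of_nat k :: complex) = of_real (m + of_nat k)" by simp
    moreover have "m + of_nat k \<noteq> 0" using m by (simp add: add_pos_nonneg less_imp_neq)
    ultimately have "of_real m + (of_nat k :: complex) \<noteq> 0" by (metis of_real_eq_0_iff)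
    moreover have "of_nat (Suc k) \<noteq> (0 :: complex)" by (rule of_nat_neq_0)
    ultimately have "- (of_nat (Suc k) * (of_real m + of_nat k)) \<noteq> (0 :: complex)" by auto
    then show ?thesis using chain[of k] that by (simp only: br_zero_right scale_eq_0_iff) auto
  qed
  then have "(br e ^^ k) w = 0 \<Longrightarrow> w = 0" for k
    by (induction k) auto
  then show ?thesis using nil by blast
qed

lemma last_nonzero:
  fixes g :: "nat \<Rightarrow> 'b::zero"
  assumes "g 0 \<noteq> 0" "\<exists>k. g k = 0"
  obtains p where "g (Suc p) = 0" "\<And>j. j \<le> p \<Longrightarrow> g j \<noteq> 0"
proof -
  define k where "k = (LEAST k. g k = 0)"
  have k: "g k = 0" "\<And>j. j < k \<Longrightarrow> g j \<noteq> 0"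
    using assms(2) not_less_Least unfolding k_def by (auto intro: LeastI_ex)
  then obtain p where "k = Suc p" using assms(1) by (cases k) auto
  then show ?thesis using k that by auto
qed

text \<open>\<open>p\<close> counts the upward steps from \<open>x\<close> to a highest vector and
  \<open>N\<close> the downward steps that are possible from there. The usual computation identifies
  \<open>N\<close> with the highest weight.\<close>

lemma sl2_string:
  assumes ef: "br e f = h" and he: "br h e = sc 2 e" and hf: "br h f = sc (- 2) f"
    and hx: "br h x = sc m x" and x: "x \<noteq> 0"
    and nil_e: "\<exists>k. (br e ^^ k) x = 0"
    and nil_f: "\<And>p. \<exists>k. (br f ^^ k) ((br e ^^ p) x) = 0"
  shows "\<exists>p N. m = of_nat N - 2 * of_nat p \<and> (\<forall>j\<le>N. (br f ^^ j) ((br e ^^ p) x) \<noteq> 0)"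
proof -
  obtain p where p: "(br e ^^ Suc p) x = 0" "\<And>j. j \<le> p \<Longrightarrow> (br e ^^ j) x \<noteq> 0"
    using last_nonzero[of "\<lambda>k. (br e ^^ k) x"] x nil_e by auto
  define v where "v = (br e ^^ p) x"
  define l where "l = m + of_nat p * 2"
  have v: "v \<noteq> 0" "br e v = 0" using p by (auto simp: v_def)
  have hv: "br h ((br f ^^ k) v) = sc (l - of_nat k * 2) ((br f ^^ k) v)" for k
    using funpow_weight[OF hf funpow_weight[OF he hx, of p], of k] by (simp add: v_def l_def)
  obtain N where N: "(br f ^^ Suc N) v = 0" "\<And>j. j \<le> N \<Longrightarrow> (br f ^^ j) v \<noteq> 0"
    using last_nonzero[of "\<lambda>k. (br f ^^ k) v"] v nil_f[of p] by (auto simp: v_def)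
  have chain: "br e ((br f ^^ Suc k) v) = sc (of_nat (Suc k) * (l - of_nat k)) ((br f ^^ k) v)" for k
  proof (induction k)
    case 0
    then show ?case using br_leibniz[of e f v] v hv[of 0] ef by simp
  next
    case (Suc k)
    have "br e ((br f ^^ Suc (Suc k)) v)
        = br h ((br f ^^ Suc k) v) + br f (br e ((br f ^^ Suc k) v))"
      using br_leibniz[of e f "(br f ^^ Suc k) v"] ef by simp
    also have "\<dots> = sc (l - of_nat (Suc k) * 2) ((br f ^^ Suc k) v)
        + sc (of_nat (Suc k) * (l - of_nat k)) ((br f ^^ Suc k) v)"
      unfolding Suc hv by (simp only: br_scale_right funpow.simps o_apply)
    also have "\<dots> = sc (of_nat (Suc (Suc k)) * (l - of_nat (Suc k))) ((br f ^^ Suc k) v)"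
      by (simp only: flip: scale_left_distrib) (simp add: algebra_simps)
    finally show ?case .
  qed
  \<comment> \<open>At the first vanishing vector of the descent the coefficient
    \<open>Suc N * (l - N)\<close> must be zero.\<close>
  have "l = of_nat N"
    using chain[of N] N(1) N(2)[of N] by (simp only: br_zero_right) (auto simp del: of_nat_Suc)
  then have "m = of_nat N - 2 * of_nat p" by (simp add: l_def algebra_simps)
  then show ?thesis using N(2) by (auto simp: v_def)
qed

end

section \<open>Coroots, reflections and multiples of roots\<close>

context simple_weight_basis
begin

lemma dual_add: "a \<in> dual_space sc H \<Longrightarrow> x \<in> H \<Longrightarrow> y \<in> H \<Longrightarrow> a (x + y) = a x + a y"
  and dual_scale: "a \<in> dual_space sc H \<Longrightarrow> x \<in> H \<Longrightarrow> a (sc c x) = c * a x"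
  and dual_outside: "a \<in> dual_space sc H \<Longrightarrow> x \<notin> H \<Longrightarrow> a x = 0"
  by (auto simp: dual_space_def)

lemma H_add: "x \<in> H \<Longrightarrow> y \<in> H \<Longrightarrow> x + y \<in> H"
  and H_diff: "x \<in> H \<Longrightarrow> y \<in> H \<Longrightarrow> x - y \<in> H"
  and H_scale: "x \<in> H \<Longrightarrow> sc c x \<in> H"
  using subspace_H by (simp_all add: subspace_add subspace_diff subspace_scale)

lemma dual_diff: "a \<in> dual_space sc H \<Longrightarrow> x \<in> H \<Longrightarrow> y \<in> H \<Longrightarrow> a (x - y) = a x - a y"
  using dual_add[of a "x - y" y] H_diff by (simp add: algebra_simps)

lemma lie_roots_dual: "a \<in> lie_roots sc br H \<Longrightarrow> a \<in> dual_space sc H"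
  by (simp add: lie_roots_def)

lemma lie_roots_nonzero:
  assumes "a \<in> lie_roots sc br H"
  obtains y where "y \<in> H" "a y \<noteq> 0"
  using assms dual_outside[of a] unfolding lie_roots_def by blast

lemma lie_roots_vector:
  assumes "a \<in> lie_roots sc br H"
  obtains x where "x \<in> \<g> a" "x \<noteq> 0"
  using assms subspace_0[OF subspace_root_space[of a]] unfolding lie_roots_def by blast

text \<open>Nondegeneracy supplies a basis vector \<open>b\<close> that is paired nontrivially with
  \<open>e\<close>. A nonzero diagonal entry of \<open>br e\<close> after \<open>br b\<close> forces
  its weight to be \<open>- a\<close> on \<open>H\<close>, and the invariance of the form keeps
  \<open>br e b\<close> from vanishing.\<close>

lemma sl2_exists:
  assumes a: "a \<in> lie_roots sc br H"
  obtains e f where "e \<in> \<g> a" "f \<in> \<g> (- a)" "a (br e f) = 2"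
proof -
  obtain y0 where y0: "y0 \<in> H" "a y0 \<noteq> 0" using a by (rule lie_roots_nonzero)
  obtain e where e: "e \<in> \<g> a" "e \<noteq> 0" using a by (rule lie_roots_vector)
  have "\<exists>b\<in>B. \<kappa> b e \<noteq> 0"
  proof (rule ccontr)
    assume *: "\<not> ?thesis"
    have "\<kappa> y e = 0" if "y \<in> span B" for y
      using that by (induction y rule: span_induct_alt)
        (use * in \<open>simp_all add: \<kappa>_add_left \<kappa>_scale_left\<close>)
    then show False using \<kappa>_nondegenerate[of e] e span_B \<kappa>_sym by simp
  qed
  then obtain b where b: "b \<in> B" "\<kappa> e b \<noteq> 0" using \<kappa>_sym by metis
  then obtain c where c: "c \<in> B" "rep (br e (br b c)) c \<noteq> 0"
    unfolding \<kappa>_def by (meson sum.neutral)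
  have "br e (br b c) \<in> \<g> (\<lambda>y. a y + (wt b y + wt c y))"
    by (rule br_root_space[OF e(1) br_root_space[OF wt_space wt_space]]) (use b c in auto)
  from rep_weight[OF this c] have "wt b y = (- a) y" if "y \<in> H" for y
    using that by (simp add: eq_neg_iff_add_eq_0 add.commute)
  then have "\<g> (wt b) = \<g> (- a)" by (rule root_space_cong)
  then have ba: "b \<in> \<g> (- a)" using wt_space[OF b(1)] by simp
  have "\<kappa> y0 (br e b) = a y0 * \<kappa> e b"
    using \<kappa>_invariant[of y0 e b] root_spaceD[OF e(1) y0(1)] by (simp add: \<kappa>_scale_left)
  then have "br e b \<noteq> 0" using y0 b \<kappa>_sym[of y0 0] by auto
  then have "a (br e b) \<noteq> 0" using bracket_eq_0[OF e(1) ba] by blast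
  show ?thesis
  proof
    show "e \<in> \<g> a" by (rule e)
    show "sc (2 / a (br e b)) b \<in> \<g> (- a)" using ba subspace_root_space subspace_scale by blast
    show "a (br e (sc (2 / a (br e b)) b)) = 2"
      using \<open>a (br e b) \<noteq> 0\<close> dual_scale[OF lie_roots_dual[OF a] br_opposite_H[OF e(1) ba]]
      by (simp add: br_scale_right)
  qed
qed

text \<open>This gives the uniqueness in the definition of \<open>coroot\<close>: on the span every
  weight is a fixed multiple of \<open>a\<close>, so the value of \<open>a\<close> determines the
  values of all weights.\<close>

lemma span_brackets:
  assumes a: "a \<in> dual_space sc H"
    and h: "h \<in> span {br x y |x y. x \<in> \<g> a \<and> y \<in> \<g> (- a)}"
    and h': "h' \<in> span {br x y |x y. x \<in> \<g> a \<and> y \<in> \<g> (- a)}"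
    and eq: "a h = a h'"
  shows "h = h'"
proof -
  obtain q :: "'a \<Rightarrow> real" where
    q: "\<And>b e f. b \<in> B \<Longrightarrow> e \<in> \<g> a \<Longrightarrow> f \<in> \<g> (- a) \<Longrightarrow> wt b (br e f) = q b * a (br e f)"
    using weight_on_bracket[of _ a] by metis
  have *: "h \<in> H \<and> (\<forall>b\<in>B. wt b h = q b * a h)"
    if "h \<in> span {br x y |x y. x \<in> \<g> a \<and> y \<in> \<g> (- a)}" for h
    using that
  proof (induction h rule: span_induct_alt)
    case base
    have "0 \<in> H" using subspace_H by (rule subspace_0)
    then have "u 0 = 0" if "u \<in> dual_space sc H" for u
      using dual_scale[OF that, of 0 0] by simp
    with a wt_dual \<open>0 \<in> H\<close> show ?case by (metis mult_zero_right)
  next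
    case (step c x y)
    then obtain e f where x: "x = br e f" "e \<in> \<g> a" "f \<in> \<g> (- a)" by blast
    then have "x \<in> H" using br_opposite_H by blast
    then show ?case
      using step a q[OF _ x(2,3)] wt_dual
      by (simp add: H_add H_scale dual_add dual_scale x(1)[symmetric] algebra_simps)
  qed
  have "h - h' = 0"
    using *[OF h] *[OF h'] eq by (intro H_eq_0) (simp_all add: H_diff dual_diff wt_dual)
  then show ?thesis by simp
qed

text \<open>The last clause is what later makes the root space of \<open>a\<close>
  one-dimensional.\<close>

lemma sl2_triple:
  assumes a: "a \<in> lie_roots sc br H"
  obtains e f h where "e \<in> \<g> a" "f \<in> \<g> (- a)" "br e f = h" "h = coroot sc br H a" "h \<in> H" "a h = 2"
    "br h e = sc 2 e" "br h f = sc (- 2) f" "\<forall>u\<in>\<g> a. \<exists>c. br u f = sc c h"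
proof -
  let ?S = "{br x y |x y. x \<in> \<g> a \<and> y \<in> \<g> (- a)}"
  obtain e f where ef: "e \<in> \<g> a" "f \<in> \<g> (- a)" "a (br e f) = 2" using a by (rule sl2_exists)
  have h: "br e f \<in> H" using ef br_opposite_H by blast
  have dual: "a \<in> dual_space sc H" using a by (rule lie_roots_dual)
  have in_span: "br u f \<in> span ?S" if "u \<in> \<g> a" for u
    using that ef(2) by (intro span_base) blast
  have "coroot sc br H a = br e f"
    unfolding coroot_def
    by (rule the_equality) (use ef in_span[OF ef(1)] span_brackets[OF dual] in auto)
  moreover have "\<exists>c. br u f = sc c (br e f)" if u: "u \<in> \<g> a" for u
  proof
    show "br u f = sc (a (br u f) / 2) (br e f)"
      by (rule span_brackets[OF dual in_span[OF u]])
        (simp_all add: span_scale in_span[OF ef(1)] dual_scale[OF dual h] ef(3))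
  qed
  moreover have "br (br e f) e = sc 2 e" "br (br e f) f = sc (- 2) f"
    using root_spaceD[OF ef(1) h] root_spaceD[OF ef(2) h] ef(3) by simp_all
  ultimately show ?thesis
    by (intro that[OF ef(1,2) refl _ h ef(3)]) auto
qed

lemma funpow_root_space:
  assumes "e \<in> \<g> a" "x \<in> \<g> b"
  shows "(br e ^^ k) x \<in> \<g> (\<lambda>y. b y + of_nat k * a y)"
proof (induction k)
  case (Suc k)
  show ?case
    by (simp, rule br_root_space[OF assms(1) Suc]) (simp add: algebra_simps)
qed (use assms in simp)

text \<open>The weights \<open>b + k * a\<close> take different values at \<open>y\<close> for
  different \<open>k\<close>, whereas only finitely many weights occur in \<open>B\<close>.\<close>

lemma br_nilpotent:
  assumes y: "y \<in> H" "a y \<noteq> 0" and e: "e \<in> \<g> a" and x: "x \<in> \<g> b"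
  shows "\<exists>k. (br e ^^ k) x = 0"
proof (rule ccontr)
  assume "\<not> ?thesis"
  then have "\<exists>c\<in>B. wt c y = b y + of_nat k * a y" for k
    using weight_occurs[OF funpow_root_space[OF e x, of k]] y(1) by metis
  then obtain c where c: "\<And>k. c k \<in> B" "\<And>k. wt (c k) y = b y + of_nat k * a y" by metis
  have "inj c"
  proof (rule injI)
    fix k j assume "c k = c j"
    then have "of_nat k * a y = of_nat j * a y" using c(2)[of k] c(2)[of j] by auto
    then show "k = j" using y(2) by auto
  qed
  moreover have "finite (range c)" using finite_B c(1) by (auto intro: finite_subset)
  ultimately show False using finite_imageD by blast
qed

text \<open>From a root vector of \<open>b\<close>, going up \<open>p\<close> steps and then down
  \<open>N - p\<close> steps reaches the reflected weight, provided that \<open>p \<le> N\<close>.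
  Going down first requires \<open>q \<le> M\<close>. Since \<open>N + M = 2 * p + 2 * q\<close>,
  one of the two ways is open.\<close>

lemma reflection_vector:
  assumes a: "a \<in> lie_roots sc br H" and b: "b \<in> lie_roots sc br H"
  shows "\<g> (root_reflection sc br H a b) \<noteq> {0}"
proof -
  obtain e f h where t: "e \<in> \<g> a" "f \<in> \<g> (- a)" "br e f = h" "h = coroot sc br H a" "h \<in> H" "a h = 2"
    "br h e = sc 2 e" "br h f = sc (- 2) f" "\<forall>u\<in>\<g> a. \<exists>c. br u f = sc c h"
    using a by (rule sl2_triple)
  obtain x where x: "x \<in> \<g> b" "x \<noteq> 0" using b by (rule lie_roots_vector)
  obtain y where y: "y \<in> H" "a y \<noteq> 0" using a by (rule lie_roots_nonzero)
  note e_pow = funpow_root_space[OF t(1)] and f_pow = funpow_root_space[OF t(2)]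
  have nil_e: "u \<in> \<g> c \<Longrightarrow> \<exists>k. (br e ^^ k) u = 0"
    and nil_f: "u \<in> \<g> c \<Longrightarrow> \<exists>k. (br f ^^ k) u = 0" for u c
    using br_nilpotent[OF y t(1)] br_nilpotent[of y "- a", OF _ _ t(2)] y by auto
  have hx: "br h x = sc (b h) x" using x t by (intro root_spaceD)
  have nonzero: ?thesis
    if "v \<in> \<g> c" "v \<noteq> 0" "\<And>z. z \<in> H \<Longrightarrow> c z = b z - b h * a z" for v c
    using that root_space_cong[of c "root_reflection sc br H a b"]
    by (auto simp: root_reflection_def t(4))
  obtain p N where pN: "b h = of_nat N - 2 * of_nat p"
    "\<And>j. j \<le> N \<Longrightarrow> (br f ^^ j) ((br e ^^ p) x) \<noteq> 0"
    using sl2_string[OF t(3,7,8) hx x(2) nil_e[OF x(1)] nil_f[OF e_pow[OF x(1)]]] by blast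
  \<comment> \<open>Exchanging \<open>e\<close> and \<open>f\<close> and negating \<open>h\<close>
    gives another triple of the same kind.\<close>
  have "br f e = - h" "br (- h) f = sc 2 f" "br (- h) e = sc (- 2) e" "br (- h) x = sc (- b h) x"
    using t br_anti[of f e] hx by (simp_all add: br_minus_left)
  from sl2_string[OF this x(2) nil_f[OF x(1)] nil_e[OF f_pow[OF x(1)]]]
  obtain q M where qM: "- b h = of_nat M - 2 * of_nat q"
    "\<And>j. j \<le> M \<Longrightarrow> (br e ^^ j) ((br f ^^ q) x) \<noteq> 0" by blast
  have "of_nat N + of_nat M = (of_nat (2 * p + 2 * q) :: complex)"
    using pN(1) qM(1) by (simp add: algebra_simps)
  then have "N + M = 2 * p + 2 * q" by (metis of_nat_add of_nat_eq_iff)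
  then consider "p \<le> N" | "q \<le> M" by linarith
  then show ?thesis
  proof cases
    case 1
    then have N: "of_nat N = (of_nat p + of_nat (N - p) :: complex)" by (simp flip: of_nat_add)
    have "(b z + of_nat p * a z) + of_nat (N - p) * (- a) z = b z - b h * a z" for z
      by (simp add: pN(1) N algebra_simps)
    then show ?thesis by (rule nonzero[OF f_pow[OF e_pow[OF x(1)]] pN(2)[OF diff_le_self]])
  next
    case 2
    then have M: "of_nat M = (of_nat q + of_nat (M - q) :: complex)" by (simp flip: of_nat_add)
    have bh: "b h = of_nat q - of_nat (M - q)" using qM(1) unfolding M by (simp add: algebra_simps)
    have "(b z + of_nat q * (- a) z) + of_nat (M - q) * a z = b z - b h * a z" for z
      by (simp add: bh algebra_simps)
    then show ?thesis by (rule nonzero[OF e_pow[OF f_pow[OF x(1)]] qM(2)[OF diff_le_self]])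
  qed
qed

lemma root_coroot:
  assumes "a \<in> lie_roots sc br H"
  shows "a (coroot sc br H a) = 2"
proof -
  obtain e f h where "e \<in> \<g> a" "f \<in> \<g> (- a)" "br e f = h" and h: "h = coroot sc br H a"
    and "h \<in> H" and two: "a h = 2" and "br h e = sc 2 e" "br h f = sc (- 2) f"
    "\<forall>u\<in>\<g> a. \<exists>c. br u f = sc c h" using assms by (rule sl2_triple)
  show ?thesis using two unfolding h .
qed

lemma root_reflection_dual:
  assumes "a \<in> dual_space sc H" "b \<in> dual_space sc H"
  shows "root_reflection sc br H a b \<in> dual_space sc H"
  using assms by (auto simp: dual_space_def root_reflection_def algebra_simps)

lemma root_reflection_root:
  assumes a: "a \<in> lie_roots sc br H" and b: "b \<in> lie_roots sc br H"
  shows "root_reflection sc br H a b \<in> lie_roots sc br H"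
proof -
  have "root_reflection sc br H a b \<noteq> (\<lambda>_. 0)"
  proof
    assume 0: "root_reflection sc br H a b = (\<lambda>_. 0)"
    define c where "c = b (coroot sc br H a)"
    have b_eq: "b x - c * a x = 0" for x
      using fun_cong[OF 0, of x] by (simp only: root_reflection_def c_def)
    \<comment> \<open>At the coroot \<open>a\<close> takes the value \<open>2\<close> and
      \<open>b\<close> the value \<open>c\<close>, so \<open>c - 2 * c = 0\<close>.\<close>
    have "c = 0" using b_eq[of "coroot sc br H a"] root_coroot[OF a] by (simp flip: c_def)
    then have "b x = 0" for x using b_eq[of x] by simp
    then have "b = (\<lambda>_. 0)" by (rule ext)
    then show False using b by (simp add: lie_roots_def)
  qed
  then show ?thesis
    using reflection_vector[OF a b] root_reflection_dual[OF lie_roots_dual[OF a] lie_roots_dual[OF b]]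
    unfolding lie_roots_def by blast
qed

text \<open>By \<open>zero\<close>, a vector \<open>w\<close> whose weight is a positive multiple of
  \<open>a\<close> vanishes if \<open>br e (br f w) = 0\<close>. Hence \<open>e\<close> spans the
  root space of \<open>a\<close>; for twice \<open>a\<close>, \<open>br f w\<close> is then a
  multiple of \<open>e\<close>, and for larger multiples it is zero by induction.\<close>

lemma root_space_multiple:
  assumes a: "a \<in> lie_roots sc br H"
  shows "\<g> (\<lambda>x. of_nat (n + 2) * a x) = {0}"
proof -
  obtain e f h where t: "e \<in> \<g> a" "f \<in> \<g> (- a)" "br e f = h" "h = coroot sc br H a" "h \<in> H"
    "a h = 2" "br h e = sc 2 e" "br h f = sc (- 2) f" "\<forall>u\<in>\<g> a. \<exists>c. br u f = sc c h"
    using a by (rule sl2_triple)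
  obtain y where y: "y \<in> H" "a y \<noteq> 0" using a by (rule lie_roots_nonzero)
  have zero: "w = 0" if "w \<in> \<g> (\<lambda>x. of_nat (Suc k) * a x)" "br e (br f w) = 0" for w k
  proof (rule sl2_positive_weight_eq_0[OF t(3,7) _ _ that(2) br_nilpotent[OF y t(1) that(1)]])
    show "br h w = sc (of_real (real (Suc k) * 2)) w" using root_spaceD[OF that(1) t(5)] t(6) by simp
  qed simp
  have one: "\<exists>c. u = sc c e" if u: "u \<in> \<g> a" for u
  proof -
    obtain c where c: "br u f = sc c h" using t(9) u by blast
    define z where "z = u - sc c e"
    have "z \<in> \<g> a" unfolding z_def
      using u t(1) subspace_root_space subspace_diff subspace_scale by blast
    moreover have "br f z = 0"
      using br_anti[of f z] c t(3) by (simp add: z_def br_diff_left br_scale_left)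
    ultimately have "z = 0" using zero[of z 0] by simp
    then show ?thesis by (auto simp: z_def)
  qed
  have "w = 0" if "w \<in> \<g> (\<lambda>x. of_nat (n + 2) * a x)" for w
    using that
  proof (induction n arbitrary: w)
    case 0
    have "br f w \<in> \<g> a" by (rule br_root_space[OF t(2) 0]) simp
    then obtain c where "br f w = sc c e" using one by blast
    then show ?case using zero[of w 1] 0 by (simp add: br_scale_right alternating)
  next
    case (Suc n)
    have "br f w \<in> \<g> (\<lambda>x. of_nat (n + 2) * a x)"
      by (rule br_root_space[OF t(2) Suc.prems]) (simp add: algebra_simps)
    then have "br f w = 0" by (rule Suc.IH)
    then show ?case using zero[of w "Suc (Suc n)"] Suc.prems by simp
  qed
  then show ?thesis using subspace_0[OF subspace_root_space] by blast
qed

lemma root_multiple: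
  assumes "a \<in> lie_roots sc br H" and na: "(\<lambda>x. of_nat n * a x) \<in> lie_roots sc br H"
  shows "n = 1"
proof -
  have zero: "n = 0 \<Longrightarrow> (\<lambda>x. of_nat n * a x) = (\<lambda>_. 0)" by simp
  have "n \<noteq> 0" using na zero unfolding lie_roots_def by blast
  moreover have "n \<noteq> k + 2" for k
    using root_space_multiple[OF assms(1), of k] na unfolding lie_roots_def by blast
  then have "\<not> n \<ge> 2" by (metis le_add_diff_inverse2)
  ultimately show ?thesis by linarith
qed

end

section \<open>Orbits of a bipartite Coxeter element\<close>

text \<open>\<open>A\<close> is the adjacency matrix of the Dynkin diagram, so that twice the
  identity minus \<open>A\<close> is the Cartan matrix; \<open>I1\<close> and \<open>I2\<close> are
  the classes of its bipartition. The points \<open>h i\<close> stand for the coroots, and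
  \<open>v\<close> is the Perron vector.\<close>

locale reflection_graph =
  fixes I1 I2 :: "'i set" and A :: "'i \<Rightarrow> 'i \<Rightarrow> int" and v :: "'i \<Rightarrow> real" and m :: nat
    and a :: "'i \<Rightarrow> 'y \<Rightarrow> complex" and h :: "'i \<Rightarrow> 'y" and \<Delta> :: "('y \<Rightarrow> complex) set"
  assumes fin: "finite I1" "finite I2" and disj: "I1 \<inter> I2 = {}"
    and A_sym: "A i j = A j i"
    and A_part: "i \<in> I1 \<Longrightarrow> j \<in> I1 \<Longrightarrow> A i j = 0" "i \<in> I2 \<Longrightarrow> j \<in> I2 \<Longrightarrow> A i j = 0"
    and v_pos: "i \<in> I1 \<union> I2 \<Longrightarrow> v i > 0"
    and perron: "i \<in> I1 \<union> I2 \<Longrightarrow> (\<Sum>j\<in>I1 \<union> I2. A i j * v j) = 2 * cos (pi / m) * v i"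
    and m: "m \<ge> 2"
    and cartan_values: "i \<in> I1 \<union> I2 \<Longrightarrow> j \<in> I1 \<union> I2 \<Longrightarrow>
      a j (h i) = of_int (2 * of_bool (i = j) - A i j)"
    and indep: "(\<And>y. (\<Sum>i\<in>I1 \<union> I2. of_int (n i) * a i y) = 0) \<Longrightarrow> i \<in> I1 \<union> I2 \<Longrightarrow> n i = 0"
    and simple: "i \<in> I1 \<union> I2 \<Longrightarrow> a i \<in> \<Delta>"
    and closed: "i \<in> I1 \<union> I2 \<Longrightarrow> f \<in> \<Delta> \<Longrightarrow> (\<lambda>y. f y - f (h i) * a i y) \<in> \<Delta>"
    and sign: "f \<in> \<Delta> \<Longrightarrow> \<exists>n :: 'i \<Rightarrow> nat. f = (\<lambda>y. \<Sum>i\<in>I1 \<union> I2. of_nat (n i) * a i y) \<or>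
      f = (\<lambda>y. - (\<Sum>i\<in>I1 \<union> I2. of_nat (n i) * a i y))"
    and multiple: "i \<in> I1 \<union> I2 \<Longrightarrow> (\<lambda>y. of_nat k * a i y) \<in> \<Delta> \<Longrightarrow> k = 1"
    and nonzero: "(\<lambda>_. 0) \<notin> \<Delta>"
begin

abbreviation "I \<equiv> I1 \<union> I2"
abbreviation "\<theta> \<equiv> pi / m"

definition part :: "'i set \<Rightarrow> bool" where "part X \<longleftrightarrow> X = I1 \<or> X = I2"

text \<open>The passage to functions from integer coefficient vectors, on which all arguments about
  signs take place.\<close>

definition \<phi> :: "('i \<Rightarrow> int) \<Rightarrow> 'y \<Rightarrow> complex" where
  "\<phi> n = (\<lambda>y. \<Sum>i\<in>I. of_int (n i) * a i y)"

definition e :: "'i \<Rightarrow> 'i \<Rightarrow> int" where "e i = (\<lambda>k. of_bool (k = i))"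

text \<open>The Cartan integer of \<open>n\<close> at \<open>i\<close>, that is, the value of
  \<open>\<phi> n\<close> at \<open>h i\<close>.\<close>

definition c :: "('i \<Rightarrow> int) \<Rightarrow> 'i \<Rightarrow> int" where "c n i = 2 * n i - (\<Sum>j\<in>I. A i j * n j)"

definition s :: "'i \<Rightarrow> ('i \<Rightarrow> int) \<Rightarrow> 'i \<Rightarrow> int" where "s i n = (\<lambda>k. n k - c n i * e i k)"

text \<open>The counterpart of \<open>s i\<close> on arbitrary functions. The order of the Coxeter
  element is taken on all functionals and not only on integer combinations of the
  \<open>a i\<close>.\<close>

definition S :: "'i \<Rightarrow> ('y \<Rightarrow> complex) \<Rightarrow> 'y \<Rightarrow> complex" where
  "S i f = (\<lambda>y. f y - f (h i) * a i y)"

text \<open>The simultaneous reflection in the simple roots of one part, in closed form;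
  \<open>foldr_part\<close> identifies it with the product.\<close>

definition \<tau> :: "'i set \<Rightarrow> ('i \<Rightarrow> int) \<Rightarrow> 'i \<Rightarrow> int" where
  "\<tau> X n = (\<lambda>i. if i \<in> X then (\<Sum>j\<in>I. A i j * n j) - n i else n i)"

text \<open>The roots as coefficient vectors; requiring support in \<open>I\<close> makes
  \<open>\<phi>\<close> injective on them.\<close>

definition R :: "('i \<Rightarrow> int) set" where "R = {n. (\<forall>i. i \<notin> I \<longrightarrow> n i = 0) \<and> \<phi> n \<in> \<Delta>}"

lemma part_zero: "part X \<Longrightarrow> i \<in> X \<Longrightarrow> j \<in> X \<Longrightarrow> A i j = 0"
  and part_subset: "part X \<Longrightarrow> X \<subseteq> I"
  using A_part by (auto simp: part_def)

lemma A_diag: "i \<in> I \<Longrightarrow> A i i = 0"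
  using A_part by auto

lemma fin_I: "finite I"
  using fin by simp

lemma sum_e: "i \<in> I \<Longrightarrow> (\<Sum>k\<in>I. g k * e i k) = g i"
  using fin_I by (simp add: e_def of_bool_def if_distrib cong: if_cong)

lemma \<phi>_e: "i \<in> I \<Longrightarrow> \<phi> (e i) = a i"
  using fin_I by (simp add: \<phi>_def e_def of_bool_def if_distrib if_distribR cong: if_cong)

lemma \<phi>_diff: "\<phi> (\<lambda>k. n k - t * n' k) = (\<lambda>y. \<phi> n y - of_int t * \<phi> n' y)"
  by (simp add: \<phi>_def algebra_simps sum_subtractf sum_distrib_left)

lemma \<phi>_values: "i \<in> I \<Longrightarrow> \<phi> n (h i) = of_int (c n i)"
proof -
  assume i: "i \<in> I"
  have "\<phi> n (h i) = (\<Sum>j\<in>I. of_int (2 * (n j * e i j) - A i j * n j))"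
    unfolding \<phi>_def using i by (intro sum.cong) (auto simp: cartan_values e_def algebra_simps)
  also have "\<dots> = of_int (c n i)"
    using i by (simp add: c_def sum_subtractf sum_e flip: of_int_sum sum_distrib_left del: of_int_diff)
  finally show ?thesis .
qed

lemma \<phi>_S: "i \<in> I \<Longrightarrow> S i (\<phi> n) = \<phi> (s i n)"
  by (simp add: S_def s_def \<phi>_diff \<phi>_values \<phi>_e)

lemma \<phi>_foldr: "set ws \<subseteq> I \<Longrightarrow> foldr S ws (\<phi> n) = \<phi> (foldr s ws n)"
  by (induction ws) (auto simp: \<phi>_S)

lemma \<phi>_inj:
  assumes "\<phi> n = \<phi> n'" "i \<in> I"
  shows "n i = n' i"
proof -
  have "\<phi> (\<lambda>k. n k - 1 * n' k) y = 0" for y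
    unfolding \<phi>_diff assms(1) by simp
  from indep[OF this[unfolded \<phi>_def] assms(2)] show ?thesis by simp
qed

lemma R_eqI: "n \<in> R \<Longrightarrow> n' \<in> R \<Longrightarrow> \<phi> n = \<phi> n' \<Longrightarrow> n = n'"
proof
  fix k assume "n \<in> R" "n' \<in> R" "\<phi> n = \<phi> n'"
  then show "n k = n' k" using \<phi>_inj[of n n' k] by (cases "k \<in> I") (simp_all add: R_def)
qed

lemma e_R: "i \<in> I \<Longrightarrow> e i \<in> R"
  unfolding R_def using simple[of i] by (simp add: \<phi>_e) (auto simp: e_def)

lemma s_R: "i \<in> I \<Longrightarrow> b \<in> R \<Longrightarrow> s i b \<in> R"
  unfolding R_def using closed[of i "\<phi> b"] \<phi>_S[of i b]
  by (simp add: S_def) (auto simp: s_def e_def)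

lemma foldr_R: "set ws \<subseteq> I \<Longrightarrow> b \<in> R \<Longrightarrow> foldr s ws b \<in> R"
  by (induction ws) (auto simp: s_R)

lemma R_sign:
  assumes b: "b \<in> R"
  shows "(\<forall>k. b k \<ge> 0) \<or> (\<forall>k. b k \<le> 0)"
proof -
  obtain n :: "'i \<Rightarrow> nat" where "\<phi> b = \<phi> (\<lambda>i. int (n i)) \<or> \<phi> b = \<phi> (\<lambda>i. - int (n i))"
    using b sign[of "\<phi> b"] by (auto simp: R_def \<phi>_def sum_negf)
  then have "(\<forall>k\<in>I. b k \<ge> 0) \<or> (\<forall>k\<in>I. b k \<le> 0)"
  proof
    assume "\<phi> b = \<phi> (\<lambda>i. int (n i))"
    from \<phi>_inj[OF this] show ?thesis by simp
  next
    assume "\<phi> b = \<phi> (\<lambda>i. - int (n i))"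
    from \<phi>_inj[OF this] show ?thesis by simp
  qed
  moreover have "b k = 0" if "k \<notin> I" for k using b that by (simp add: R_def)
  ultimately show ?thesis by (metis order_refl)
qed

lemma R_nonzero:
  assumes b: "b \<in> R"
  obtains i where "i \<in> I" "b i \<noteq> 0"
proof -
  have "\<phi> b \<noteq> (\<lambda>_. 0)" using b nonzero by (auto simp: R_def)
  moreover have "\<phi> b = (\<lambda>_. 0)" if "\<forall>i\<in>I. b i = 0" using that by (simp add: \<phi>_def)
  ultimately show ?thesis using that by blast
qed

text \<open>\<open>s i\<close> alters only the coordinate at \<open>i\<close>, so a positive root
  that it makes negative is supported there, and the only nonnegative multiple of \<open>a i\<close>
  in \<open>\<Delta>\<close> is \<open>a i\<close> itself.\<close>

lemma simple_unique:
  assumes b: "b \<in> R" and pos: "\<And>k. b k \<ge> 0" and i: "i \<in> I" and neg: "\<And>k. s i b k \<le> 0"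
  shows "b = e i"
proof -
  have off: "b k = 0" if "k \<noteq> i" for k
    using pos[of k] neg[of k] that by (simp add: s_def e_def)
  then have b_eq: "b = (\<lambda>k. b i * e i k)" by (auto simp: e_def)
  have "\<phi> b = (\<lambda>y. of_nat (nat (b i)) * a i y)"
    using pos[of i] fin_I i
    by (subst b_eq) (simp add: \<phi>_def e_def of_bool_def if_distrib if_distribR cong: if_cong)
  then have "nat (b i) = 1" using multiple[OF i] b by (simp add: R_def)
  then have "b i = 1" by linarith
  then show ?thesis using off by (auto simp: e_def fun_eq_iff)
qed

section \<open>Words in the simple reflections and the deletion condition\<close>

lemma s_e: "i \<in> I \<Longrightarrow> s i (e i) = (\<lambda>k. - e i k)"
  using sum_e[of i "A i"] A_diag[of i] by (auto simp: s_def c_def e_def)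

lemma foldr_minus: "foldr s ws (\<lambda>k. - n k) = (\<lambda>k. - foldr s ws n k)"
  by (induction ws arbitrary: n) (simp_all add: s_def c_def sum_negf fun_eq_iff algebra_simps)

lemma S_S: "i \<in> I \<Longrightarrow> S i (S i f) = f"
  by (simp add: S_def cartan_values A_diag fun_eq_iff algebra_simps)

lemma foldr_S_linear:
  "foldr S ws (\<lambda>y. f y - t * g y) = (\<lambda>y. foldr S ws f y - t * foldr S ws g y)"
  by (induction ws) (simp_all add: S_def algebra_simps)

text \<open>Through the points \<open>h k\<close>, which play the role of the coroots, functions are paired with
  coefficient vectors. This pairing replaces the invariant form, which functions outside the span
  of the \<open>a i\<close> do not have.\<close>

lemma pairing_step:
  assumes i: "i \<in> I"
  shows "(\<Sum>k\<in>I. of_int (s i n k) * S i f (h k)) = (\<Sum>k\<in>I. of_int (n k) * f (h k))"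
proof -
  let ?D = "\<lambda>k. (of_int (2 * e i k - A k i) :: complex)"
  have D: "a i (h k) = ?D k" if "k \<in> I" for k
    using that i by (simp add: cartan_values e_def)
  have sumD: "(\<Sum>k\<in>I. of_int (n k) * ?D k) = of_int (c n i)" for n
  proof -
    have "(\<Sum>k\<in>I. n k * (2 * e i k - A k i)) = 2 * (\<Sum>k\<in>I. n k * e i k) - (\<Sum>k\<in>I. A i k * n k)"
      by (simp add: A_sym[of _ i] algebra_simps sum_subtractf sum_distrib_left)
    then show ?thesis
      using i by (simp add: sum_e c_def flip: of_int_mult of_int_sum del: of_int_diff)
  qed
  have sum_e': "(\<Sum>k\<in>I. of_int (e i k) * g k) = g i" for g :: "'i \<Rightarrow> complex"
    using i fin_I by (simp add: e_def of_bool_def if_distrib if_distribR cong: if_cong)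
  have "(\<Sum>k\<in>I. of_int (s i n k) * S i f (h k))
      = (\<Sum>k\<in>I. of_int (n k) * f (h k) - of_int (c n i) * (of_int (e i k) * f (h k))
          - f (h i) * (of_int (n k) * ?D k) + of_int (c n i) * f (h i) * (of_int (e i k) * ?D k))"
    by (intro sum.cong refl) (simp add: s_def S_def D algebra_simps)
  also have "\<dots> = (\<Sum>k\<in>I. of_int (n k) * f (h k)) - of_int (c n i) * f (h i)
      - f (h i) * of_int (c n i) + of_int (c n i) * f (h i) * ?D i"
    by (simp only: sum.distrib sum_subtractf flip: sum_distrib_left) (simp only: sum_e' sumD)
  also have "?D i = 2" using i by (simp add: e_def A_diag)
  finally show ?thesis by (simp add: algebra_simps)
qed

lemma pairing_foldr:
  "set ws \<subseteq> I \<Longrightarrow>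
    (\<Sum>k\<in>I. of_int (foldr s ws n k) * foldr S ws f (h k)) = (\<Sum>k\<in>I. of_int (n k) * f (h k))"
  by (induction ws) (simp_all add: pairing_step)

text \<open>The conjugation rule for reflections: the word carries \<open>a i\<close> to
  \<open>a j\<close>, and by the invariance of the pairing the image of \<open>f\<close> has at
  \<open>h j\<close> the value of \<open>f\<close> at \<open>h i\<close>.\<close>

lemma foldr_conj:
  assumes ws: "set ws \<subseteq> I" and i: "i \<in> I" and j: "j \<in> I" and eq: "foldr s ws (e i) = e j"
  shows "foldr S ws (S i f) = S j (foldr S ws f)"
proof -
  have sum_e': "(\<Sum>k\<in>I. of_int (e i k) * g k) = g i" if "i \<in> I" for i and g :: "'i \<Rightarrow> complex"
    using that fin_I by (simp add: e_def of_bool_def if_distrib if_distribR cong: if_cong)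
  have "foldr S ws f (h j) = f (h i)"
    using pairing_foldr[OF ws, of "e i" f] i j by (simp add: eq sum_e')
  moreover have "foldr S ws (a i) = a j"
    using \<phi>_foldr[OF ws, of "e i"] i j by (simp add: eq \<phi>_e)
  ultimately show ?thesis unfolding S_def[of i] S_def[of j] foldr_S_linear by simp
qed

text \<open>Read from the right, the word starts with a positive root and ends with a negative one.
  The letter at which the sign first changes must be that of the simple root reached just
  before.\<close>

lemma sign_change:
  assumes "set ws \<subseteq> I" "i \<in> I" "\<And>k. foldr s ws (e i) k \<le> 0"
  shows "\<exists>us j vs. ws = us @ j # vs \<and> foldr s vs (e i) = e j"
  using assms
proof (induction ws)
  case Nil
  then show ?case using Nil.prems(3)[of i] by (simp add: e_def)
next
  case (Cons j ws)
  let ?b = "foldr s ws (e i)"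
  have b: "?b \<in> R" using Cons.prems by (intro foldr_R e_R) auto
  from R_sign[OF b] show ?case
  proof
    assume "\<forall>k. ?b k \<ge> 0"
    then have "?b = e j" using Cons.prems b by (intro simple_unique) auto
    then show ?thesis by (intro exI[of _ "[]"]) auto
  next
    assume "\<forall>k. ?b k \<le> 0"
    then obtain us j' vs where "ws = us @ j' # vs" "foldr s vs (e i) = e j'"
      using Cons.IH Cons.prems(1,2) by auto
    then show ?thesis by (intro exI[of _ "j # us"]) auto
  qed
qed

text \<open>The deletion argument: the last letter of a nonempty word of this kind cancels against an
  earlier one.\<close>

lemma positive_word_id:
  assumes "set ws \<subseteq> I" and "\<And>i k. i \<in> I \<Longrightarrow> foldr s ws (e i) k \<ge> 0"
  shows "foldr S ws f = f"
  using assms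
proof (induction ws rule: length_induct)
  case (1 ws)
  show ?case
  proof (cases ws rule: rev_cases)
    case (snoc u i)
    then have u: "set u \<subseteq> I" and i: "i \<in> I" using "1.prems" by auto
    \<comment> \<open>The last letter sends \<open>e i\<close> to its negative, so the rest of the
      word has to make \<open>e i\<close> negative.\<close>
    have "foldr s u (e i) k \<le> 0" for k
      using "1.prems"(2)[OF i, of k] i by (simp add: snoc s_e foldr_minus)
    then obtain us j vs where split: "u = us @ j # vs" and eq: "foldr s vs (e i) = e j"
      using sign_change[OF u i] by metis
    then have sub: "set us \<subseteq> I" "set vs \<subseteq> I" and j: "j \<in> I" using u by auto
    \<comment> \<open>The conjugation rule moves \<open>S i\<close> to the left of
      \<open>vs\<close>, where it becomes a second \<open>S j\<close> and cancels the first.\<close>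
    have shorter: "foldr S ws g = foldr S (us @ vs) g" for g
      using sub i j by (simp add: snoc split foldr_conj[OF sub(2) i j eq] S_S)
    have "foldr s (us @ vs) (e l) k \<ge> 0" if l: "l \<in> I" for l k
    proof -
      have uv: "set (us @ vs) \<subseteq> I" using sub by simp
      have "\<phi> (foldr s (us @ vs) (e l)) = \<phi> (foldr s ws (e l))"
        using shorter[of "\<phi> (e l)"] by (simp only: \<phi>_foldr[OF "1.prems"(1)] \<phi>_foldr[OF uv])
      then have "foldr s (us @ vs) (e l) = foldr s ws (e l)"
        by (intro R_eqI foldr_R[OF uv] foldr_R[OF "1.prems"(1)] e_R l)
      then show ?thesis using "1.prems" l by simp
    qed
    then have "foldr S (us @ vs) f = f"
      using "1.IH" sub by (intro "1.IH"[rule_format]) (auto simp: snoc split)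
    then show ?thesis using shorter by simp
  qed simp
qed

section \<open>The product of the reflections of one part\<close>

text \<open>There are no edges inside a part, so the neighbour sum at a letter is not affected by
  the letters applied before it.\<close>

lemma foldr_part:
  assumes "distinct ws" "set ws \<subseteq> X" "part X"
  shows "foldr s ws n = \<tau> (set ws) n"
  using assms
proof (induction ws)
  case Nil
  then show ?case by (simp add: \<tau>_def)
next
  case (Cons i ws)
  have i: "i \<in> X" "i \<in> I" using Cons.prems part_subset by auto
  have "(\<Sum>j\<in>I. A i j * \<tau> (set ws) n j) = (\<Sum>j\<in>I. A i j * n j)"
    using Cons.prems part_zero[of X i] by (intro sum.cong) (auto simp: \<tau>_def)
  then show ?case using Cons by (auto simp: s_def c_def e_def \<tau>_def fun_eq_iff)
qed

lemma \<tau>_R: "part X \<Longrightarrow> b \<in> R \<Longrightarrow> \<tau> X b \<in> R"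
proof -
  assume X: "part X" and b: "b \<in> R"
  obtain ws where ws: "set ws = X" "distinct ws"
    using finite_distinct_list[of X] fin X by (auto simp: part_def)
  show "\<tau> X b \<in> R"
    using foldr_part[of ws X b] foldr_R[of ws b] ws X b part_subset[OF X] by simp
qed

text \<open>The coordinates outside \<open>X\<close> do not change, so they are zero and
  \<open>b\<close> lives on \<open>X\<close>, where there are no edges. Hence a single
  \<open>s i\<close> with \<open>b i > 0\<close> already produces a negative root.\<close>

lemma \<tau>_simple:
  assumes X: "part X" and b: "b \<in> R" and pos: "\<And>k. b k \<ge> 0" and neg: "\<And>k. \<tau> X b k \<le> 0"
  shows "\<exists>i\<in>X. b = e i"
proof -
  have off: "b k = 0" if "k \<notin> X" for k
    using pos[of k] neg[of k] that by (simp add: \<tau>_def)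
  obtain i where i: "i \<in> I" "b i \<noteq> 0" using b by (rule R_nonzero)
  then have iX: "i \<in> X" using off by blast
  have sum0: "(\<Sum>j\<in>I. A i j * b j) = 0"
    using part_zero[OF X iX] off by (intro sum.neutral) (metis mult_eq_0_iff)
  have "s i b i < 0" using i pos[of i] by (simp add: s_def c_def sum0 e_def)
  then have "s i b k \<le> 0" for k using R_sign[OF s_R[OF i(1) b]] by (metis not_le)
  then have "b = e i" by (rule simple_unique[OF b pos i(1)])
  then show ?thesis using iX by blast
qed

lemma \<tau>_e: "part X \<Longrightarrow> i \<in> X \<Longrightarrow> \<tau> X (e i) = (\<lambda>k. - e i k)"
proof
  fix k assume X: "part X" "i \<in> X"
  then have "i \<in> I" using part_subset by auto
  then show "\<tau> X (e i) k = - e i k"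
    using X part_zero[of X k i] by (auto simp: \<tau>_def sum_e) (auto simp: e_def)
qed

section \<open>The projection to the plane of the Perron vector\<close>

definition \<sigma> :: "('i \<Rightarrow> int) \<Rightarrow> 'i \<Rightarrow> int" where "\<sigma> = \<tau> I2 \<circ> \<tau> I1"

definition wsum :: "'i set \<Rightarrow> ('i \<Rightarrow> int) \<Rightarrow> real" where "wsum X n = (\<Sum>i\<in>X. v i * n i)"

text \<open>The projection in a complex coordinate, chosen so that the simple roots of
  \<open>I1\<close> and the negatives of those of \<open>I2\<close> fall on two rays at the angle
  \<open>\<theta>\<close>.\<close>

definition F :: "('i \<Rightarrow> int) \<Rightarrow> complex" where "F n = wsum I1 n - cis (- \<theta>) * wsum I2 n"

lemma part_I [simp]: "part I1" "part I2"
  by (simp_all add: part_def)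

lemma wsum_other: "X \<inter> Y = {} \<Longrightarrow> wsum Y (\<tau> X n) = wsum Y n"
  unfolding wsum_def by (intro sum.cong) (auto simp: \<tau>_def)

text \<open>Exchanging the summations and using the symmetry of \<open>A\<close> brings in the
  neighbour sums of \<open>v\<close> at the vertices of \<open>Y\<close>, which the eigenvalue
  equation evaluates.\<close>

lemma wsum_\<tau>:
  assumes X: "part X" and Y: "part Y" and XY: "X \<union> Y = I" "X \<inter> Y = {}"
  shows "wsum X (\<tau> X n) = 2 * cos \<theta> * wsum Y n - wsum X n"
proof -
  have fXY: "finite X" "finite Y" using XY(1) fin_I by (metis finite_Un)+
  have split: "(\<Sum>j\<in>I. g j) = (\<Sum>j\<in>X. g j) + (\<Sum>j\<in>Y. g j)" for g :: "'i \<Rightarrow> real"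
    using XY fXY by (simp add: sum.union_disjoint flip: XY(1))
  have "wsum X (\<tau> X n) = (\<Sum>i\<in>X. v i * (\<Sum>j\<in>I. A i j * n j)) - wsum X n"
    by (simp add: wsum_def \<tau>_def algebra_simps sum_subtractf)
  also have "(\<Sum>i\<in>X. v i * (\<Sum>j\<in>I. A i j * n j)) = (\<Sum>i\<in>X. \<Sum>j\<in>Y. v i * A i j * n j)"
    using part_zero[OF X] by (simp add: split sum_distrib_left mult.assoc)
  also have "\<dots> = (\<Sum>j\<in>Y. \<Sum>i\<in>X. v i * A i j * n j)" by (rule sum.swap)
  also have "\<dots> = (\<Sum>j\<in>Y. n j * (\<Sum>i\<in>X. A j i * v i))"
    unfolding sum_distrib_left by (intro sum.cong refl, subst A_sym) (simp only: mult_ac)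
  also have "\<dots> = (\<Sum>j\<in>Y. n j * (\<Sum>i\<in>I. A j i * v i))"
    using part_zero[OF Y] by (intro sum.cong) (simp_all add: split)
  also have "\<dots> = (\<Sum>j\<in>Y. n j * (2 * cos \<theta> * v j))"
    using perron part_subset[OF Y] by (intro sum.cong) auto
  also have "\<dots> = 2 * cos \<theta> * wsum Y n"
    by (simp add: wsum_def sum_distrib_left algebra_simps)
  finally show ?thesis .
qed

text \<open>On the plane of the Perron vector both \<open>\<tau> I1\<close> and \<open>\<tau> I2\<close> act as reflections, so that
  \<open>\<sigma>\<close> acts as a rotation by \<open>- 2 * \<theta>\<close>.\<close>

lemma F_\<sigma>: "F (\<sigma> n) = cis (- 2 * \<theta>) * F n"
proof -
  have w1: "wsum I1 (\<sigma> n) = 2 * cos \<theta> * wsum I2 n - wsum I1 n"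
    using wsum_other[of I2 I1 "\<tau> I1 n"] wsum_\<tau>[of I1 I2 n] disj by (simp add: \<sigma>_def Int_commute)
  have "wsum I2 (\<sigma> n) = 2 * cos \<theta> * wsum I1 (\<tau> I1 n) - wsum I2 n"
    using wsum_other[of I1 I2 n] wsum_\<tau>[of I2 I1 "\<tau> I1 n"] disj
    by (simp add: \<sigma>_def Int_commute Un_commute)
  then have w2: "wsum I2 (\<sigma> n) = 2 * cos \<theta> * (2 * cos \<theta> * wsum I2 n - wsum I1 n) - wsum I2 n"
    using wsum_\<tau>[of I1 I2 n] disj by simp
  \<comment> \<open>With \<open>x = cis \<theta>\<close> and its inverse \<open>y\<close>, twice the
    cosine is \<open>x + y\<close>, and the claim becomes a polynomial identity modulo
    \<open>x * y = 1\<close>.\<close>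
  have two: "2 * complex_of_real (cos \<theta>) = cis \<theta> + cis (- \<theta>)"
    by (simp add: complex_eq_iff)
  have inv: "cis \<theta> * cis (- \<theta>) = 1" and sq: "cis (- 2 * \<theta>) = cis (- \<theta>) * cis (- \<theta>)"
    by (simp_all add: cis_mult)
  define P Q x y where "P = complex_of_real (wsum I1 n)" "Q = complex_of_real (wsum I2 n)"
    "x = cis \<theta>" "y = cis (- \<theta>)"
  have "F (\<sigma> n) = ((x + y) * Q - P) - y * ((x + y) * ((x + y) * Q - P) - Q)"
    unfolding F_def w1 w2 by (simp add: P_Q_x_y_def flip: two)
  also have "\<dots> = y * y * (P - y * Q) + (1 - x * y) * (Q * (x + 2 * y) - P)"
    by (simp add: algebra_simps)
  also have "\<dots> = cis (- 2 * \<theta>) * F n"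
    using inv unfolding sq F_def by (simp add: P_Q_x_y_def)
  finally show ?thesis .
qed

lemma F_\<sigma>_pow: "F ((\<sigma> ^^ k) n) = cis (- 2 * \<theta>) ^ k * F n"
  by (induction k) (simp_all add: F_\<sigma>)

lemma \<theta>_range: "0 < \<theta>" "\<theta> < pi"
  using m by (auto simp: field_simps)

text \<open>Since \<open>sin \<theta>\<close> is positive, \<open>1\<close> and
  \<open>cis (- \<theta>)\<close> are independent over the reals.\<close>

lemma F_eqD:
  assumes "F n = F n'"
  shows "wsum I1 n = wsum I1 n'" "wsum I2 n = wsum I2 n'"
proof -
  have "sin \<theta> * wsum I2 n = sin \<theta> * wsum I2 n'"
    using arg_cong[OF assms, of Im] by (simp add: F_def)
  then show "wsum I2 n = wsum I2 n'" using sin_gt_zero[OF \<theta>_range] by simp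
  then show "wsum I1 n = wsum I1 n'" using arg_cong[OF assms, of Re] by (simp add: F_def)
qed

lemma wsum_minus: "wsum X (\<lambda>k. - n k) = - wsum X n"
  by (simp add: wsum_def sum_negf)

lemma wsum_pos:
  assumes n: "i \<in> I" "n i \<noteq> 0" and pos: "\<And>k. n k \<ge> 0"
  shows "wsum I1 n + wsum I2 n > 0"
proof -
  have v: "v k \<ge> 0" if "k \<in> I" for k using v_pos[OF that] by simp
  have "wsum I1 n + wsum I2 n = (\<Sum>i\<in>I. v i * n i)"
    using fin disj by (simp add: wsum_def sum.union_disjoint)
  also have "\<dots> > 0"
  proof (rule sum_pos2[OF fin_I n(1)])
    have "n i > 0" using n(2) pos[of i] by simp
    then show "0 < v i * n i" using v_pos[OF n(1)] by simp
    show "0 \<le> v k * n k" if "k \<in> I" for k using v[OF that] pos[of k] by simp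
  qed
  finally show ?thesis .
qed

lemma R_wsum_pos: "b \<in> R \<Longrightarrow> (\<And>k. b k \<ge> 0) \<Longrightarrow> wsum I1 b + wsum I2 b > 0"
  by (metis R_nonzero wsum_pos)

lemma R_wsum_neg:
  assumes b: "b \<in> R" and neg: "\<And>k. b k \<le> 0"
  shows "wsum I1 b + wsum I2 b < 0"
proof -
  obtain i where "i \<in> I" "b i \<noteq> 0" using b by (rule R_nonzero)
  then have "wsum I1 (\<lambda>k. - b k) + wsum I2 (\<lambda>k. - b k) > 0"
    using neg by (intro wsum_pos[of i]) simp_all
  then show ?thesis by (simp add: wsum_minus)
qed

lemma F_nonzero: "b \<in> R \<Longrightarrow> F b \<noteq> 0"
proof
  assume b: "b \<in> R" "F b = 0"
  have "F (\<lambda>_. 0) = 0" by (simp add: F_def wsum_def)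
  with b(2) have "wsum I1 b = 0" "wsum I2 b = 0"
    using F_eqD[of b "\<lambda>_. 0"] by (simp_all add: wsum_def)
  then show False using R_sign[OF b(1)] R_wsum_pos[OF b(1)] R_wsum_neg[OF b(1)] by force
qed

section \<open>The order of the Coxeter element\<close>

lemma \<sigma>_R: "b \<in> R \<Longrightarrow> \<sigma> b \<in> R"
  by (simp add: \<sigma>_def \<tau>_R)

lemma \<sigma>_pow_R: "b \<in> R \<Longrightarrow> (\<sigma> ^^ k) b \<in> R"
  by (induction k) (simp_all add: \<sigma>_R)

lemma cis_\<theta>_eq_1:
  assumes "cis (\<theta> * of_int t) = 1"
  shows "\<exists>j. t = 2 * int m * j"
proof -
  have "cos (\<theta> * of_int t) = 1" using arg_cong[OF assms, of Re] by simp
  then obtain j :: int where "\<theta> * of_int t = of_int j * 2 * pi" using cos_one_2pi_int by blast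
  then have "pi * of_int t = pi * of_int (2 * int m * j)" using m by (simp add: field_simps)
  then have "(of_int t :: real) = of_int (2 * int m * j)" by simp
  then show ?thesis by (metis of_int_eq_iff)
qed

lemma cis_pow: "cis (- 2 * \<theta>) ^ k = cis (\<theta> * of_int (- 2 * int k))"
  by (simp add: Complex.DeMoivre algebra_simps)

lemma cis_pow_eq_1: "cis (- 2 * \<theta>) ^ k = 1 \<longleftrightarrow> m dvd k"
proof
  assume "cis (- 2 * \<theta>) ^ k = 1"
  then obtain j where "- 2 * int k = 2 * int m * j" unfolding cis_pow using cis_\<theta>_eq_1 by blast
  then have "int k = int m * (- j)" by (simp add: algebra_simps)
  then have "int m dvd int k" by (rule dvdI)
  then show "m dvd k" by simp
next
  assume "m dvd k"
  then obtain j where "k = m * j" by (rule dvdE)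
  moreover have "cis (- 2 * \<theta>) ^ m = 1" using m by (simp add: Complex.DeMoivre complex_eq_iff)
  ultimately show "cis (- 2 * \<theta>) ^ k = 1" by (simp add: power_mult)
qed

text \<open>A single word represents the power on functions and on coefficient vectors at once,
  because the deletion argument draws a conclusion about the former from signs of the
  latter.\<close>

lemma \<sigma>_word:
  assumes "set ws1 = I1" "distinct ws1" "set ws2 = I2" "distinct ws2"
  shows "\<exists>ws. set ws \<subseteq> I \<and> foldr S ws = (foldr S ws2 \<circ> foldr S ws1) ^^ k \<and>
    (\<forall>n. foldr s ws n = (\<sigma> ^^ k) n)"
proof (induction k)
  case 0
  show ?case by (intro exI[of _ "[]"]) auto
next
  case (Suc k)
  then obtain ws where ws: "set ws \<subseteq> I" "foldr S ws = (foldr S ws2 \<circ> foldr S ws1) ^^ k"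
    "\<And>n. foldr s ws n = (\<sigma> ^^ k) n" by blast
  have "foldr S ((ws2 @ ws1) @ ws) = (foldr S ws2 \<circ> foldr S ws1) ^^ Suc k"
  proof
    show "foldr S ((ws2 @ ws1) @ ws) g = ((foldr S ws2 \<circ> foldr S ws1) ^^ Suc k) g" for g
      by (simp add: ws(2))
  qed
  moreover have "foldr s ((ws2 @ ws1) @ ws) n = (\<sigma> ^^ Suc k) n" for n
    using ws(3)[of n] assms foldr_part[of ws1 I1] foldr_part[of ws2 I2] by (simp add: \<sigma>_def)
  moreover have "set ((ws2 @ ws1) @ ws) \<subseteq> I" using ws(1) assms by auto
  ultimately show ?case by blast
qed

text \<open>The rotation has order \<open>m\<close>, so \<open>\<sigma> ^^ m\<close> preserves
  \<open>F\<close> and with it the sum of the coordinates weighted by \<open>v\<close>. Among the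
  roots this sum is positive only for positive ones.\<close>

lemma \<sigma>_pow_m_pos: "i \<in> I \<Longrightarrow> (\<sigma> ^^ m) (e i) k \<ge> 0"
proof -
  assume i: "i \<in> I"
  let ?b = "(\<sigma> ^^ m) (e i)"
  have F: "F ?b = F (e i)" using cis_pow_eq_1[of m] by (simp add: F_\<sigma>_pow)
  have "wsum I1 ?b + wsum I2 ?b > 0"
    using R_wsum_pos[OF e_R[OF i]] F_eqD[OF F] by (simp add: e_def)
  then show ?thesis using R_sign[of ?b] R_wsum_neg[of ?b] \<sigma>_pow_R[OF e_R[OF i], of m] by force
qed

lemma word_pow_m:
  assumes "set ws \<subseteq> I" "\<And>n. foldr s ws n = (\<sigma> ^^ m) n"
  shows "foldr S ws f = f"
  using assms by (intro positive_word_id) (simp_all add: \<sigma>_pow_m_pos)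

lemma \<sigma>_pow_m:
  assumes "b \<in> R"
  shows "(\<sigma> ^^ m) b = b"
proof -
  obtain ws1 where ws1: "set ws1 = I1" "distinct ws1" using finite_distinct_list[OF fin(1)] by auto
  obtain ws2 where ws2: "set ws2 = I2" "distinct ws2" using finite_distinct_list[OF fin(2)] by auto
  obtain ws where ws: "set ws \<subseteq> I" "\<And>n. foldr s ws n = (\<sigma> ^^ m) n"
    using \<sigma>_word[OF ws1 ws2] by metis
  show ?thesis
    using word_pow_m[OF ws, of "\<phi> b"] assms \<phi>_foldr[OF ws(1), of b] ws(2)[of b] \<sigma>_pow_R[OF assms, of m]
    by (intro R_eqI) simp_all
qed

lemma \<sigma>_pow_mod: "b \<in> R \<Longrightarrow> (\<sigma> ^^ k) b = (\<sigma> ^^ (k mod m)) b"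
proof -
  assume b: "b \<in> R"
  have "(\<sigma> ^^ (m * j)) b = b" for j
    by (induction j) (simp_all add: funpow_add \<sigma>_pow_m b)
  then have "(\<sigma> ^^ (k mod m + m * (k div m))) b = (\<sigma> ^^ (k mod m)) b"
    by (simp only: funpow_add o_apply)
  then show ?thesis by simp
qed

text \<open>\<open>F b\<close> is nonzero and is multiplied by the \<open>k\<close>-th power of a
  primitive \<open>m\<close>-th root of unity.\<close>

lemma \<sigma>_pow_fixed: "b \<in> R \<Longrightarrow> (\<sigma> ^^ k) b = b \<Longrightarrow> m dvd k"
  using F_\<sigma>_pow[of k b] F_nonzero[of b] cis_pow_eq_1 by simp

section \<open>Orbits through the signed simple roots\<close>

definition \<beta> :: "'i \<Rightarrow> 'i \<Rightarrow> int" where "\<beta> i = (if i \<in> I1 then e i else (\<lambda>k. - e i k))"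

lemma \<beta>_R: "i \<in> I \<Longrightarrow> \<beta> i \<in> R"
  using e_R[of i] s_R[of i "e i"] s_e[of i] by (simp add: \<beta>_def)

lemma wsum_e: "part X \<Longrightarrow> wsum X (e i) = (if i \<in> X then v i else 0)"
proof -
  assume "part X"
  then have "finite X" using fin by (auto simp: part_def)
  then show ?thesis by (simp add: wsum_def e_def of_bool_def if_distrib cong: if_cong)
qed

lemma F_\<beta>: "i \<in> I \<Longrightarrow> F (\<beta> i) = cis (\<theta> * of_int (if i \<in> I1 then 0 else - 1)) * v i"
  using disj by (auto simp: F_def \<beta>_def wsum_minus wsum_e)

lemma \<beta>_disjoint:
  assumes i: "i \<in> I" and j: "j \<in> I" and eq: "(\<sigma> ^^ k) (\<beta> i) = \<beta> j"
  shows "i = j"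
proof -
  define t where "t i = (if i \<in> I1 then 0 else - 1 :: int)" for i
  have F_t: "F (\<beta> i) = cis (\<theta> * of_int (t i)) * v i" if "i \<in> I" for i
    using F_\<beta>[OF that] by (simp only: t_def)
  have cis_k: "cis (\<theta> * of_int (- 2 * int k + t i)) = cis (- 2 * \<theta>) ^ k * cis (\<theta> * of_int (t i))"
    by (simp only: cis_pow cis_mult of_int_add distrib_left)
  have F: "cis (\<theta> * of_int (- 2 * int k + t i)) * v i = cis (\<theta> * of_int (t j)) * v j"
    using F_\<sigma>_pow[of k "\<beta> i"] unfolding eq F_t[OF i] F_t[OF j] cis_k by (simp only: mult.assoc)
  have "v i = v j"
    using arg_cong[OF F, of norm] v_pos[OF i] v_pos[OF j] by (simp add: norm_mult)
  then have "cis (\<theta> * of_int (- 2 * int k + t i)) = cis (\<theta> * of_int (t j))"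
    using F v_pos[OF j] by simp
  then have "cis (\<theta> * of_int (- 2 * int k + t i)) / cis (\<theta> * of_int (t j)) = 1" by simp
  then have "cis (\<theta> * of_int (- 2 * int k + t i - t j)) = 1"
    by (simp add: cis_divide algebra_simps)
  then obtain r where r: "- 2 * int k + t i - t j = 2 * int m * r" using cis_\<theta>_eq_1 by blast
  \<comment> \<open>In units of \<open>\<theta>\<close> the rotation and the full turn are even,
    whereas the two rays are one unit apart; so both roots project to the same ray.\<close>
  then have "even (t i - t j)" by (metis add_diff_eq dvd_triv_left even_add even_mult_iff even_minus even_numeral)
  then have tt: "t i = t j" by (auto simp: t_def split: if_splits)
  then have "int k = int m * (- r)" using r by (simp add: algebra_simps)
  then have "m dvd k" by (metis dvd_triv_left int_dvd_int_iff)
  then have "\<beta> i = \<beta> j" using \<sigma>_pow_mod[OF \<beta>_R[OF i], of k] eq by simp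
  then have "e i = e j" using tt by (auto simp: \<beta>_def t_def fun_eq_iff split: if_splits)
  then show "i = j" by (metis e_def of_bool_eq_iff)
qed

text \<open>Either the sign changes under \<open>\<tau> I1\<close>, and \<open>b\<close> is a simple
  root of \<open>I1\<close>, or it changes under \<open>\<tau> I2\<close>, and
  \<open>\<sigma> b\<close> is the negative of a simple root of \<open>I2\<close>.\<close>

lemma descent_reaches_\<beta>:
  assumes b: "b \<in> R" and pos: "\<And>k. b k \<ge> 0" and neg: "\<And>k. \<sigma> b k \<le> 0"
  shows "\<exists>i\<in>I. b = \<beta> i \<or> \<sigma> b = \<beta> i"
proof -
  have "\<tau> I1 b \<in> R" using b by (simp add: \<tau>_R)
  from R_sign[OF this] show ?thesis
  proof
    assume "\<forall>k. \<tau> I1 b k \<le> 0"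
    then obtain i where "i \<in> I1" "b = e i" using \<tau>_simple[OF part_I(1) b pos] by blast
    then show ?thesis by (auto simp: \<beta>_def)
  next
    assume "\<forall>k. \<tau> I1 b k \<ge> 0"
    then obtain j where j: "j \<in> I2" "\<tau> I1 b = e j"
      using \<tau>_simple[OF part_I(2) \<open>\<tau> I1 b \<in> R\<close>] neg by (auto simp: \<sigma>_def)
    then have "\<sigma> b = \<beta> j" using \<tau>_e[OF part_I(2) j(1)] disj by (auto simp: \<sigma>_def \<beta>_def)
    then show ?thesis using j by blast
  qed
qed

text \<open>The first \<open>m\<close> powers of an \<open>m\<close>-th root of unity other than
  \<open>1\<close> sum to zero; \<open>m \<ge> 2\<close> excludes \<open>1\<close>.\<close>

lemma orbit_sum:
  assumes "b \<in> R"
  shows "(\<Sum>k<m. wsum I1 ((\<sigma> ^^ k) b)) = 0" "(\<Sum>k<m. wsum I2 ((\<sigma> ^^ k) b)) = 0"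
proof -
  let ?z = "cis (- 2 * \<theta>)"
  have "?z \<noteq> 1" using cis_pow_eq_1[of 1] m by simp
  then have "(\<Sum>k<m. ?z ^ k) = 0" using cis_pow_eq_1[of m] by (simp add: geometric_sum)
  then have "(\<Sum>k<m. F ((\<sigma> ^^ k) b)) = 0" by (simp add: F_\<sigma>_pow flip: sum_distrib_right)
  then have F: "F (\<lambda>i. \<Sum>k<m. (\<sigma> ^^ k) b i) = F (\<lambda>_. 0)"
    unfolding F_def wsum_def
    by (simp add: sum_distrib_left sum_subtractf sum.swap[of _ _ "{..<m}"])
  have "wsum X (\<lambda>i. \<Sum>k<m. (\<sigma> ^^ k) b i) = (\<Sum>k<m. wsum X ((\<sigma> ^^ k) b))" for X
    by (simp add: wsum_def sum_distrib_left sum.swap[of _ _ "{..<m}"])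
  then show "(\<Sum>k<m. wsum I1 ((\<sigma> ^^ k) b)) = 0" "(\<Sum>k<m. wsum I2 ((\<sigma> ^^ k) b)) = 0"
    using F_eqD[OF F] by (simp_all add: wsum_def)
qed

lemma orbit_reaches_\<beta>:
  assumes b: "b \<in> R"
  shows "\<exists>k. \<exists>i\<in>I. (\<sigma> ^^ k) b = \<beta> i"
proof -
  define p where "p k \<longleftrightarrow> (\<forall>i. (\<sigma> ^^ k) b i \<ge> 0)" for k
  have sum0: "(\<Sum>k<m. wsum I1 ((\<sigma> ^^ k) b) + wsum I2 ((\<sigma> ^^ k) b)) = 0"
    using orbit_sum[OF b] by (simp add: sum.distrib)
  have neg: "\<forall>i. (\<sigma> ^^ k) b i \<le> 0" if "\<not> p k" for k
    using R_sign[OF \<sigma>_pow_R[OF b]] that by (auto simp: p_def)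
  have "\<exists>k. p k"
  proof (rule ccontr)
    assume "\<not> ?thesis"
    then have "wsum I1 ((\<sigma> ^^ k) b) + wsum I2 ((\<sigma> ^^ k) b) < 0" for k
      using R_wsum_neg[OF \<sigma>_pow_R[OF b]] neg by blast
    then have "(\<Sum>k<m. wsum I1 ((\<sigma> ^^ k) b) + wsum I2 ((\<sigma> ^^ k) b)) < (\<Sum>k<m. 0)"
      using m by (intro sum_strict_mono) (auto simp: lessThan_empty_iff)
    then show False using sum0 by simp
  qed
  then obtain k0 where k0: "p k0" ..
  have "\<exists>k. \<not> p k"
  proof (rule ccontr)
    assume "\<not> ?thesis"
    then have "wsum I1 ((\<sigma> ^^ k) b) + wsum I2 ((\<sigma> ^^ k) b) > 0" for k
      using R_wsum_pos[OF \<sigma>_pow_R[OF b]] by (simp add: p_def)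
    then have "(\<Sum>k<m. 0) < (\<Sum>k<m. wsum I1 ((\<sigma> ^^ k) b) + wsum I2 ((\<sigma> ^^ k) b))"
      using m by (intro sum_strict_mono) (auto simp: lessThan_empty_iff)
    then show False using sum0 by simp
  qed
  then obtain k1 where "\<not> p k1" ..
  \<comment> \<open>Periodicity moves the negative root behind the positive one at
    \<open>k0\<close>, so that a step from positive to negative lies in between.\<close>
  moreover have "(\<sigma> ^^ (k1 + m * k0)) b = (\<sigma> ^^ k1) b"
    using \<sigma>_pow_mod[OF b, of "k1 + m * k0"] \<sigma>_pow_mod[OF b, of k1] by simp
  ultimately have k1: "\<not> p (k1 + m * k0)" by (simp add: p_def)
  have "\<exists>k. p k \<and> \<not> p (Suc k)"
  proof (rule ccontr)
    assume *: "\<not> ?thesis"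
    have "p (k0 + d)" for d by (induction d) (use k0 * in auto)
    moreover have "k0 \<le> k1 + m * k0" using m by (simp add: trans_le_add2)
    ultimately show False using k1 by (metis le_add_diff_inverse)
  qed
  then obtain k where k: "p k" "\<not> p (Suc k)" by blast
  then have "\<exists>i\<in>I. (\<sigma> ^^ k) b = \<beta> i \<or> \<sigma> ((\<sigma> ^^ k) b) = \<beta> i"
    using neg[OF k(2)] by (intro descent_reaches_\<beta> \<sigma>_pow_R[OF b]) (auto simp: p_def)
  then show ?thesis by (metis funpow.simps(2) o_apply)
qed

section \<open>Transfer from coefficient vectors to functions\<close>

lemma \<phi>_\<Delta>: "n \<in> R \<Longrightarrow> \<phi> n \<in> \<Delta>"
  by (simp add: R_def)

lemma \<Delta>_coefficients:
  assumes f: "f \<in> \<Delta>"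
  obtains n where "n \<in> R" "f = \<phi> n"
proof -
  obtain k :: "'i \<Rightarrow> nat" where "f = \<phi> (\<lambda>i. int (k i)) \<or> f = \<phi> (\<lambda>i. - int (k i))"
    using sign[OF f] by (auto simp: \<phi>_def sum_negf)
  then obtain n where n: "f = \<phi> n" by blast
  define n' where "n' i = (if i \<in> I then n i else 0)" for i
  have "\<phi> n' = f" unfolding n \<phi>_def n'_def by (intro ext sum.cong) auto
  then show ?thesis using f by (intro that[of n']) (auto simp: R_def n'_def)
qed

context
  fixes ws1 ws2 :: "'i list" and w :: "('y \<Rightarrow> complex) \<Rightarrow> 'y \<Rightarrow> complex" and b :: "'i \<Rightarrow> 'y \<Rightarrow> complex"
  assumes ws1: "set ws1 = I1" "distinct ws1" and ws2: "set ws2 = I2" "distinct ws2"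
    and w: "w = foldr S ws2 \<circ> foldr S ws1"
    and b: "\<And>i. b i = (if i \<in> I1 then a i else - a i)"
begin

lemma \<phi>_coxeter_pow: "(w ^^ k) (\<phi> n) = \<phi> ((\<sigma> ^^ k) n)"
proof -
  have "w (\<phi> n) = \<phi> (\<sigma> n)" for n
    using foldr_part[of ws1 I1 n] foldr_part[of ws2 I2 "\<tau> I1 n"] ws1 ws2
    by (simp add: w \<phi>_foldr \<sigma>_def)
  then show ?thesis by (induction k) simp_all
qed

lemma coxeter_pow_m: "(w ^^ m) f = f"
proof -
  obtain ws where "set ws \<subseteq> I" "foldr S ws = w ^^ m" "\<And>n. foldr s ws n = (\<sigma> ^^ m) n"
    using \<sigma>_word[OF ws1 ws2] unfolding w by metis
  then show ?thesis using word_pow_m[of ws f] by simp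
qed

lemma b_\<phi>: "i \<in> I \<Longrightarrow> b i = \<phi> (\<beta> i)"
  using \<phi>_e[of i] by (auto simp: b \<beta>_def \<phi>_def sum_negf fun_eq_iff)

lemma b_\<Delta>: "i \<in> I \<Longrightarrow> b i \<in> \<Delta>"
  using b_\<phi> \<beta>_R by (simp add: R_def)

lemma coxeter_pow_\<Delta>:
  assumes "f \<in> \<Delta>"
  shows "(w ^^ k) f \<in> \<Delta>"
proof -
  obtain n where n: "n \<in> R" "f = \<phi> n" using assms by (rule \<Delta>_coefficients)
  show ?thesis unfolding n(2) \<phi>_coxeter_pow by (intro \<phi>_\<Delta> \<sigma>_pow_R n(1))
qed

lemma coxeter_pow_fixed:
  assumes f: "f \<in> \<Delta>" and fixed: "(w ^^ k) f = f"
  shows "m dvd k"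
proof -
  obtain n where n: "n \<in> R" "f = \<phi> n" using f by (rule \<Delta>_coefficients)
  have "(\<sigma> ^^ k) n = n"
    using fixed unfolding n(2) \<phi>_coxeter_pow by (intro R_eqI \<sigma>_pow_R n(1))
  then show ?thesis using \<sigma>_pow_fixed[OF n(1)] by blast
qed

lemma coxeter_orbits_disjoint:
  assumes i: "i \<in> I" and j: "j \<in> I" and eq: "(w ^^ k) (b i) = b j"
  shows "i = j"
proof (rule \<beta>_disjoint[OF i j])
  show "(\<sigma> ^^ k) (\<beta> i) = \<beta> j"
    using eq unfolding b_\<phi>[OF i] b_\<phi>[OF j] \<phi>_coxeter_pow by (intro R_eqI \<sigma>_pow_R \<beta>_R i j)
qed

lemma coxeter_orbit_reaches:
  assumes "f \<in> \<Delta>"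
  shows "\<exists>k. \<exists>i\<in>I. (w ^^ k) f = b i"
proof -
  obtain n where n: "n \<in> R" "f = \<phi> n" using assms by (rule \<Delta>_coefficients)
  obtain k i where "i \<in> I" "(\<sigma> ^^ k) n = \<beta> i" using orbit_reaches_\<beta>[OF n(1)] by blast
  then show ?thesis using b_\<phi>[of i] unfolding n(2) \<phi>_coxeter_pow by metis
qed

end
end

section \<open>Perron vectors of the Dynkin diagrams\<close>

text \<open>The sum runs over the neighbours of \<open>i\<close>, so \<open>v\<close> is a positive
  eigenvector of the adjacency matrix. The number \<open>m\<close> turns out to be the Coxeter
  number.\<close>

definition perron_pair :: "dynkin_type \<Rightarrow> nat \<Rightarrow> (nat \<Rightarrow> real) \<Rightarrow> bool" where
  "perron_pair X m v \<longleftrightarrow> m \<ge> 2 \<and> (\<forall>i\<in>{1..dynkin_rank X}. v i > 0 \<and>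
     (\<Sum>j | j \<in> {1..dynkin_rank X} \<and> (dynkin_edge X i j \<or> dynkin_edge X j i). v j) = 2 * cos (pi / m) * v i)"

lemma sin_step:
  fixes t :: real
  shows "sin (real k * t) + sin (real (k + 2) * t) = 2 * cos t * sin (real (k + 1) * t)"
proof -
  have "real k * t = real (k + 1) * t - t" "real (k + 2) * t = real (k + 1) * t + t"
    by (simp_all add: algebra_simps)
  then show ?thesis by (simp only: sin_diff sin_add) (simp add: algebra_simps)
qed

lemma sin_mult_pos: "0 < k \<Longrightarrow> k < m \<Longrightarrow> 0 < sin (real k * (pi / real m))"
  by (rule sin_gt_zero) (simp_all add: field_simps)

text \<open>The ends of a path are treated like inner vertices: a neighbour may be missing where
  \<open>v\<close> vanishes.\<close>

lemma sum_neighbours: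
  fixes i :: nat
  assumes "i \<ge> 1" "N \<subseteq> {i - 1, i + 1}" "\<And>j. j \<in> {i - 1, i + 1} - N \<Longrightarrow> v j = 0"
  shows "(\<Sum>j\<in>N. v j) = v (i - 1) + (v (i + 1) :: real)"
proof -
  have "(\<Sum>j\<in>N. v j) = (\<Sum>j\<in>{i - 1, i + 1}. v j)"
    using assms by (intro sum.mono_neutral_left) auto
  also have "i - 1 \<noteq> i + 1" using assms(1) by linarith
  then have "(\<Sum>j\<in>{i - 1, i + 1}. v j) = v (i - 1) + v (i + 1)" by simp
  finally show ?thesis .
qed

lemma sin_step_at: "i \<ge> 1 \<Longrightarrow> sin (real (i - 1) * t) + sin (real (i + 1) * t) = 2 * cos t * sin (real i * t)"
  using sin_step[of "i - 1" t] by (simp add: add.commute)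

section \<open>Eigenvectors for the types A and D\<close>

text \<open>The sines vanish at \<open>0\<close> and \<open>l + 1\<close>, the places just beyond
  the two ends of the path.\<close>

lemma perron_pair_A:
  assumes "l \<ge> 1"
  shows "perron_pair (TypeA l) (l + 1) (\<lambda>k. sin (real k * (pi / (l + 1))))"
  unfolding perron_pair_def
proof (intro conjI ballI)
  fix i assume i: "i \<in> {1..dynkin_rank (TypeA l)}"
  let ?v = "\<lambda>k. sin (real k * (pi / real (l + 1)))"
  show "?v i > 0" using i by (intro sin_mult_pos) auto
  have "(\<Sum>j | j \<in> {1..dynkin_rank (TypeA l)} \<and> (dynkin_edge (TypeA l) i j \<or> dynkin_edge (TypeA l) j i). ?v j)
      = ?v (i - 1) + ?v (i + 1)"
  proof (rule sum_neighbours)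
    fix j assume "j \<in> {i - 1, i + 1} - {j. j \<in> {1..dynkin_rank (TypeA l)} \<and> (dynkin_edge (TypeA l) i j \<or> dynkin_edge (TypeA l) j i)}"
    then have "j = 0 \<or> j = l + 1" using i by auto
    then show "?v j = 0" by (auto simp del: of_nat_Suc of_nat_add)
  qed (use i in auto)
  also have "\<dots> = 2 * cos (pi / real (l + 1)) * ?v i" using i by (intro sin_step_at) auto
  finally show "(\<Sum>j | j \<in> {1..dynkin_rank (TypeA l)} \<and> (dynkin_edge (TypeA l) i j \<or> dynkin_edge (TypeA l) j i). ?v j)
      = 2 * cos (pi / real (l + 1)) * ?v i" .
qed (use assms in auto)

text \<open>For the angle \<open>pi / (2 * n - 2)\<close> the sine reaches \<open>1\<close> at
  \<open>n - 1\<close>; this value is shared equally by the end vertices \<open>n - 1\<close> and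
  \<open>n\<close> of the fork.\<close>

lemma perron_pair_D:
  assumes "n \<ge> 4"
  shows "\<exists>v. perron_pair (TypeD n) (2 * n - 2) v"
proof -
  define t where "t = pi / real (2 * n - 2)"
  define v where "v k = (if k \<le> n - 2 then sin (real k * t) else 1 / 2)" for k
  have nt: "real (2 * n - 2) * t = pi" using assms by (simp add: t_def)
  have "real (n - 2) * t = pi / 2 - t" "real (n - 3) * t = pi / 2 - 2 * t"
    using nt assms by (simp_all add: of_nat_diff algebra_simps)
  then have s2: "sin (real (n - 2) * t) = cos t" and s3: "sin (real (n - 3) * t) = cos (2 * t)"
    by (simp_all add: sin_diff cos_diff)
  have "t < pi / 2" using assms by (simp add: t_def field_simps)
  moreover have "0 < t" using assms by (simp add: t_def)
  ultimately have cos_pos: "cos t > 0" by (intro cos_gt_zero)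
  have v_end: "v (n - 3) = cos (2 * t)" "v (n - 2) = cos t" "v (n - 1) = 1 / 2" "v n = 1 / 2"
    unfolding v_def s3[symmetric] s2[symmetric] using assms by auto
  have "perron_pair (TypeD n) (2 * n - 2) v"
    unfolding perron_pair_def t_def[symmetric]
  proof (intro conjI ballI)
    fix i assume i: "i \<in> {1..dynkin_rank (TypeD n)}"
    let ?N = "{j. j \<in> {1..dynkin_rank (TypeD n)} \<and> (dynkin_edge (TypeD n) i j \<or> dynkin_edge (TypeD n) j i)}"
    show "v i > 0"
    proof (cases "i \<le> n - 2")
      case True
      then have "sin (real i * t) > 0" unfolding t_def using i assms by (intro sin_mult_pos) auto
      then show ?thesis using True by (simp add: v_def)
    qed (simp add: v_def)
    consider "i \<le> n - 3" | "i = n - 2" | "i = n - 1" | "i = n" using i by fastforce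
    then show "(\<Sum>j\<in>?N. v j) = 2 * cos t * v i"
    proof cases
      case 1
      have "(\<Sum>j\<in>?N. v j) = v (i - 1) + v (i + 1)"
      proof (rule sum_neighbours)
        fix j assume "j \<in> {i - 1, i + 1} - ?N"
        then have "j = 0" using i 1 assms by auto
        then show "v j = 0" by (simp add: v_def)
      qed (use i 1 assms in auto)
      also have "\<dots> = 2 * cos t * v i"
        using i 1 assms sin_step_at[of i t] by (auto simp: v_def)
      finally show ?thesis .
    next
      case 2
      then have "?N = {n - 3, n - 1, n}" using assms by auto
      moreover have "n - 3 \<noteq> n - 1" "n - 3 \<noteq> n" "n - 1 \<noteq> n" using assms by auto
      ultimately have "(\<Sum>j\<in>?N. v j) = cos (2 * t) + 1" by (simp add: v_end del: One_nat_def)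
      then show ?thesis using 2 by (simp add: v_end cos_double_cos power2_eq_square)
    next
      case 3
      then have "?N = {n - 2}" using assms by auto
      then show ?thesis using 3 by (simp add: v_end del: One_nat_def)
    next
      case 4
      then have "?N = {n - 2}" using assms by auto
      then show ?thesis using 4 by (simp add: v_end)
    qed
  qed (use assms in auto)
  then show ?thesis by blast
qed

section \<open>Eigenvectors for the exceptional types\<close>

text \<open>On the long arm \<open>v\<close> is a sine counted from the end \<open>n\<close>. On the
  short arms its values follow from the eigenvalue equations there and the value \<open>S\<close> at
  the branch vertex \<open>4\<close>. What is left is the equation at \<open>4\<close>, which is
  \<open>node\<close>.\<close>

lemma perron_pair_E:
  assumes n: "n \<ge> 5" and m: "m > n" and t: "t = pi / real m"
    and node: "sin (real (n - 4) * t) + sin (real (n - 3) * t) / (2 * cos t)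
      + 2 * cos t * sin (real (n - 3) * t) / ((2 * cos t)\<^sup>2 - 1) = 2 * cos t * sin (real (n - 3) * t)"
  shows "\<exists>v. perron_pair (TypeE n) m v"
proof -
  define x where "x = 2 * cos t"
  define S where "S = sin (real (n - 3) * t)"
  define v where "v k = (if k = 1 then S / (x\<^sup>2 - 1) else if k = 2 then S / x
    else if k = 3 then x * S / (x\<^sup>2 - 1) else sin (real (n + 1 - k) * t))" for k
  have "t < pi / 3" "0 < t" using n m by (simp_all add: t field_simps)
  then have "cos (pi / 3) < cos t" by (intro cos_monotone_0_pi) auto
  then have x: "x > 1" by (simp add: x_def cos_60)
  then have x2: "x\<^sup>2 > 1" by (simp add: one_less_power)
  have S: "S > 0" unfolding S_def t using n m by (intro sin_mult_pos) auto
  have "perron_pair (TypeE n) m v"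
    unfolding perron_pair_def t[symmetric]
  proof (intro conjI ballI)
    fix i assume i: "i \<in> {1..dynkin_rank (TypeE n)}"
    let ?N = "{j. j \<in> {1..dynkin_rank (TypeE n)} \<and> (dynkin_edge (TypeE n) i j \<or> dynkin_edge (TypeE n) j i)}"
    have "sin (real (n + 1 - i) * t) > 0" unfolding t using i n m by (intro sin_mult_pos) auto
    then show "v i > 0" using S x x2 by (simp add: v_def)
    have v: "v 1 = S / (x\<^sup>2 - 1)" "v 2 = S / x" "v 3 = x * S / (x\<^sup>2 - 1)" "v 4 = S"
      "v 5 = sin (real (n - 4) * t)"
      by (simp_all add: v_def S_def)
    consider "i = 1" | "i = 2" | "i = 3" | "i = 4" | "i \<ge> 5" using i by fastforce
    then show "(\<Sum>j\<in>?N. v j) = 2 * cos t * v i"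
    proof cases
      case 1
      then have "?N = {3}" using n by auto
      then have "(\<Sum>j\<in>?N. v j) = v 3" by simp
      also have "\<dots> = x * v 1" unfolding v by simp
      finally show ?thesis using 1 by (simp add: x_def)
    next
      case 2
      then have "?N = {4}" using n by auto
      then show ?thesis using 2 x by (simp add: v flip: x_def)
    next
      case 3
      then have "?N = {1, 4}" using n by auto
      then have "(\<Sum>j\<in>?N. v j) = v 1 + v 4" by simp
      also have "\<dots> = x * v 3" unfolding v using x2 by (simp add: field_simps power2_eq_square)
      finally show ?thesis using 3 by (simp add: x_def)
    next
      case 4
      then have "?N = {2, 3, 5}" using n by auto
      then have "(\<Sum>j\<in>?N. v j) = v 5 + v 2 + v 3" by simp
      also have "\<dots> = x * v 4" using node unfolding v x_def S_def .
      finally show ?thesis using 4 by (simp add: x_def)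
    next
      case 5
      define k where "k = n + 1 - i"
      have "(\<Sum>j\<in>?N. v j) = v (i - 1) + v (i + 1)"
      proof (rule sum_neighbours)
        fix j assume "j \<in> {i - 1, i + 1} - ?N"
        \<comment> \<open>One place beyond the end of the long arm the formula for \<open>v\<close>
          gives \<open>sin 0\<close>.\<close>
        then have "j = n + 1" using i 5 by auto
        then show "v j = 0" using n by (simp add: v_def)
      qed (use i 5 in auto)
      also have "\<dots> = sin (real (k + 1) * t) + sin (real (k - 1) * t)"
      proof -
        have "n + 1 - (i - 1) = k + 1" "n + 1 - (i + 1) = k - 1" using i 5 by (auto simp: k_def)
        then show ?thesis using 5 by (simp only: v_def) auto
      qed
      also have "\<dots> = 2 * cos t * sin (real k * t)"
        using sin_step_at[of k t] i unfolding k_def by (subst add.commute) auto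
      also have "sin (real k * t) = v i" using 5 by (simp add: v_def k_def)
      finally show ?thesis .
    qed
  qed (use n m in auto)
  then show ?thesis by blast
qed

text \<open>The factors of \<open>sin t\<close> are the Chebyshev polynomials of the second kind,
  written in \<open>2 * cos t\<close>.\<close>

lemma sin_multiples:
  fixes t :: real
  shows "sin (2 * t) = 2 * cos t * sin t"
    and "sin (3 * t) = ((2 * cos t)\<^sup>2 - 1) * sin t"
    and "sin (4 * t) = ((2 * cos t) ^ 3 - 2 * (2 * cos t)) * sin t"
    and "sin (5 * t) = ((2 * cos t) ^ 4 - 3 * (2 * cos t)\<^sup>2 + 1) * sin t"
proof -
  show s2: "sin (2 * t) = 2 * cos t * sin t" by (simp add: sin_double)
  show s3: "sin (3 * t) = ((2 * cos t)\<^sup>2 - 1) * sin t"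
    using sin_step[of 1 t] s2 by (simp add: algebra_simps power2_eq_square)
  show s4: "sin (4 * t) = ((2 * cos t) ^ 3 - 2 * (2 * cos t)) * sin t"
  proof -
    have "sin (4 * t) = 2 * cos t * sin (3 * t) - sin (2 * t)" using sin_step[of 2 t] by simp
    then show ?thesis unfolding s2 s3 by (simp add: algebra_simps power2_eq_square power3_eq_cube)
  qed
  show "sin (5 * t) = ((2 * cos t) ^ 4 - 3 * (2 * cos t)\<^sup>2 + 1) * sin t"
  proof -
    have "sin (5 * t) = 2 * cos t * sin (4 * t) - sin (3 * t)" using sin_step[of 3 t] by simp
    then show ?thesis
      unfolding s3 s4 by (simp add: algebra_simps power2_eq_square power3_eq_cube power4_eq_xxxx)
  qed
qed

lemma cos_step:
  fixes t :: real
  shows "cos (real (k + 2) * t) = 2 * cos t * cos (real (k + 1) * t) - cos (real k * t)"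
proof -
  have "real k * t = real (k + 1) * t - t" "real (k + 2) * t = real (k + 1) * t + t"
    by (simp_all add: algebra_simps)
  then show ?thesis by (simp only: cos_diff cos_add) (simp add: algebra_simps)
qed

lemma clear_denominators:
  fixes x d :: real
  assumes "x \<noteq> 0" "d \<noteq> 0" "a * x * d + b * d + x * x * b = x * x * b * d"
  shows "a + b / x + x * b / d = x * b"
  using assms by (simp add: field_simps)

text \<open>In each case \<open>cos (pi / 3)\<close> or \<open>cos (pi / 6)\<close> is a Chebyshev polynomial of
  \<open>z = 2 * cos (2 * t)\<close>; this gives the minimal polynomial of \<open>z = (2 * cos t)\<^sup>2 - 2\<close>.\<close>

lemma branch_node_E:
  assumes "(n, m) \<in> {(6, 12), (7, 18), (8, 30)}" and t: "t = pi / real m"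
  shows "sin (real (n - 4) * t) + sin (real (n - 3) * t) / (2 * cos t)
      + 2 * cos t * sin (real (n - 3) * t) / ((2 * cos t)\<^sup>2 - 1) = 2 * cos t * sin (real (n - 3) * t)"
proof -
  define x where "x = 2 * cos t"
  define z where "z = 2 * cos (2 * t)"
  have z: "z = x\<^sup>2 - 2" by (simp add: z_def x_def cos_double_cos power_mult_distrib)
  have "2 * t < pi / 3" "0 < t" using assms by auto
  then have "cos (pi / 3) < cos (2 * t)" by (intro cos_monotone_0_pi) auto
  then have z1: "z > 1" by (simp add: z_def cos_60)
  then have x2: "x\<^sup>2 - 1 \<noteq> 0" and x0: "x \<noteq> 0" by (auto simp: z)
  have c2: "2 * cos (4 * t) = z\<^sup>2 - 2"
    using cos_double_cos[of "2 * t"] by (simp add: z_def power_mult_distrib)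
  have c3: "2 * cos (6 * t) = z ^ 3 - 3 * z"
  proof -
    have "2 * cos (6 * t) = z * (2 * cos (4 * t)) - z"
      using cos_step[of 1 "2 * t"] by (simp add: z_def)
    then show ?thesis unfolding c2 by (simp add: algebra_simps power2_eq_square power3_eq_cube)
  qed
  consider "n = 6" "m = 12" | "n = 7" "m = 18" | "n = 8" "m = 30" using assms by auto
  then show ?thesis
  proof cases
    case 1
    have "z = sqrt 3" using 1 cos_30 by (simp add: t z_def)
    then have "z\<^sup>2 = 3" by simp
    moreover have "x ^ 4 - 4 * x\<^sup>2 + 1 = z\<^sup>2 - 3" unfolding z by algebra
    ultimately have p: "x ^ 4 - 4 * x\<^sup>2 + 1 = 0" by simp
    have "sin (2 * t) + sin (3 * t) / x + x * sin (3 * t) / (x\<^sup>2 - 1) = x * sin (3 * t)"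
    proof -
      \<comment> \<open>With the denominators cleared, the two sides of the branch equation differ
        by a multiple of the polynomial that vanishes by \<open>p\<close>; the other two cases end
        in the same way.\<close>
      have "(x * sin t) * x * (x\<^sup>2 - 1) + ((x\<^sup>2 - 1) * sin t) * (x\<^sup>2 - 1) + x * x * ((x\<^sup>2 - 1) * sin t) - x * x * ((x\<^sup>2 - 1) * sin t) * (x\<^sup>2 - 1)
          = - sin t * ((x\<^sup>2 - 1) * (x ^ 4 - 4 * x\<^sup>2 + 1))" by algebra
      then show ?thesis
        unfolding sin_multiples x_def[symmetric] by (intro clear_denominators[OF x0 x2]) (simp add: p)
    qed
    then show ?thesis using 1 by (simp add: x_def)
  next
    case 2
    have "cos (6 * t) = 1 / 2" using 2 cos_60 by (simp add: t)
    then have "z ^ 3 - 3 * z - 1 = 0" using c3 by simp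
    moreover have "x ^ 6 - 6 * x ^ 4 + 9 * x\<^sup>2 - 3 = z ^ 3 - 3 * z - 1" unfolding z by algebra
    ultimately have p: "x ^ 6 - 6 * x ^ 4 + 9 * x\<^sup>2 - 3 = 0" by simp
    have "sin (3 * t) + sin (4 * t) / x + x * sin (4 * t) / (x\<^sup>2 - 1) = x * sin (4 * t)"
    proof -
      have "((x\<^sup>2 - 1) * sin t) * x * (x\<^sup>2 - 1) + ((x ^ 3 - 2 * x) * sin t) * (x\<^sup>2 - 1) + x * x * ((x ^ 3 - 2 * x) * sin t) - x * x * ((x ^ 3 - 2 * x) * sin t) * (x\<^sup>2 - 1)
          = - sin t * (x * (x ^ 6 - 6 * x ^ 4 + 9 * x\<^sup>2 - 3))" by algebra
      then show ?thesis
        unfolding sin_multiples x_def[symmetric] by (intro clear_denominators[OF x0 x2]) (simp add: p)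
    qed
    then show ?thesis using 2 by (simp add: x_def)
  next
    case 3
    have c4: "2 * cos (8 * t) = z ^ 4 - 4 * z\<^sup>2 + 2"
    proof -
      have "2 * cos (8 * t) = z * (2 * cos (6 * t)) - 2 * cos (4 * t)"
        using cos_step[of 2 "2 * t"] by (simp add: z_def)
      then show ?thesis
        unfolding c2 c3 by (simp add: algebra_simps power2_eq_square power3_eq_cube power4_eq_xxxx)
    qed
    have c5: "2 * cos (10 * t) = z ^ 5 - 5 * z ^ 3 + 5 * z"
    proof -
      have "2 * cos (10 * t) = z * (2 * cos (8 * t)) - 2 * cos (6 * t)"
        using cos_step[of 3 "2 * t"] by (simp add: z_def)
      then show ?thesis unfolding c3 c4 by algebra
    qed
    have "cos (10 * t) = 1 / 2" using 3 cos_60 by (simp add: t)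
    then have "z ^ 5 - 5 * z ^ 3 + 5 * z - 1 = 0" using c5 by simp
    \<comment> \<open>The factor \<open>z - 1\<close> comes from the angle
      \<open>2 * t = pi / 3\<close>, which solves the same Chebyshev equation and is excluded by
      \<open>z > 1\<close>.\<close>
    then have "(z - 1) * (z ^ 4 + z ^ 3 - 4 * z\<^sup>2 - 4 * z + 1) = 0" by algebra
    then have "z ^ 4 + z ^ 3 - 4 * z\<^sup>2 - 4 * z + 1 = 0" using z1 by simp
    moreover have "x ^ 8 - 7 * x ^ 6 + 14 * x ^ 4 - 8 * x\<^sup>2 + 1 = z ^ 4 + z ^ 3 - 4 * z\<^sup>2 - 4 * z + 1"
      unfolding z by algebra
    ultimately have p: "x ^ 8 - 7 * x ^ 6 + 14 * x ^ 4 - 8 * x\<^sup>2 + 1 = 0" by simp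
    have "sin (4 * t) + sin (5 * t) / x + x * sin (5 * t) / (x\<^sup>2 - 1) = x * sin (5 * t)"
    proof -
      have "((x ^ 3 - 2 * x) * sin t) * x * (x\<^sup>2 - 1) + ((x ^ 4 - 3 * x\<^sup>2 + 1) * sin t) * (x\<^sup>2 - 1) + x * x * ((x ^ 4 - 3 * x\<^sup>2 + 1) * sin t) - x * x * ((x ^ 4 - 3 * x\<^sup>2 + 1) * sin t) * (x\<^sup>2 - 1)
          = - sin t * ((x ^ 8 - 7 * x ^ 6 + 14 * x ^ 4 - 8 * x\<^sup>2 + 1))" by algebra
      then show ?thesis
        unfolding sin_multiples x_def[symmetric] by (intro clear_denominators[OF x0 x2]) (simp add: p)
    qed
    then show ?thesis using 3 by (simp add: x_def)
  qed
qed

lemma perron_pair_exists: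
  assumes "(X = TypeA l \<and> odd l) \<or> (X = TypeD l \<and> 4 \<le> l) \<or> X = TypeE 6 \<or> X = TypeE 7 \<or> X = TypeE 8"
  shows "\<exists>m v. perron_pair X m v"
proof -
  have E: "\<exists>v. perron_pair (TypeE n) m v" if "(n, m) \<in> {(6, 12), (7, 18), (8, 30)}" for n m
    using that by (intro perron_pair_E[OF _ _ refl branch_node_E[OF that refl]]) auto
  consider "X = TypeA l" "l \<ge> 1" | "X = TypeD l" "4 \<le> l" | "X = TypeE 6" | "X = TypeE 7" | "X = TypeE 8"
    using assms odd_pos[of l] by auto
  then show ?thesis
  proof cases
    case 1
    then show ?thesis using perron_pair_A by blast
  next
    case 2
    then show ?thesis using perron_pair_D by blast
  qed (use E[of 6 12] E[of 7 18] E[of 8 30] in auto)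
qed

text \<open>Twice the identity minus the Cartan matrix is the adjacency matrix; \<open>loop\<close>
  keeps \<open>i\<close> from being counted as its own neighbour.\<close>

lemma perron_pair_cartan:
  assumes v: "perron_pair X m v" and i: "i \<in> {1..dynkin_rank X}"
    and loop: "\<not> dynkin_edge X i i"
  shows "(\<Sum>j = 1..dynkin_rank X. of_int (2 * of_bool (i = j) - cartan_matrix X i j) * v j)
    = 2 * cos (pi / m) * v i"
proof -
  have "of_int (2 * of_bool (i = j) - cartan_matrix X i j) * v j
      = (if dynkin_edge X i j \<or> dynkin_edge X j i then v j else 0)" for j
    using loop by (cases "i = j") (simp_all add: cartan_matrix_def)
  then have "(\<Sum>j = 1..dynkin_rank X. of_int (2 * of_bool (i = j) - cartan_matrix X i j) * v j)
      = (\<Sum>j | j \<in> {1..dynkin_rank X} \<and> (dynkin_edge X i j \<or> dynkin_edge X j i). v j)"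
    by (simp only: sum.inter_filter[OF finite_atLeastAtMost, symmetric])
  also have "\<dots> = 2 * cos (pi / m) * v i" using v i unfolding perron_pair_def by blast
  finally show ?thesis .
qed

section \<open>Coxeter orbits in the root system\<close>

text \<open>The inverse of \<open>w\<close> is \<open>w ^^ (m - 1)\<close>, so every element of the
  group is a natural power, with exponent reduced modulo \<open>m\<close>.\<close>

lemma group_orbit_cyclic:
  assumes pow: "\<And>f. (w ^^ m) f = f" and m: "m > 0"
  shows "group_orbit (cyclic_group_gen w) b = (\<lambda>k. (w ^^ k) b) ` {..<m}"
proof -
  have w1: "w \<circ> (w ^^ (m - 1)) = id" "(w ^^ (m - 1)) \<circ> w = id"
    using pow m by (cases m; auto simp: fun_eq_iff funpow_swap1)+
  then have inv_w: "inv w = w ^^ (m - 1)" by (metis inv_unique_comp)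
  have inv_pow: "inv w ^^ n = w ^^ ((m - 1) * n)" for n
    unfolding inv_w by (simp add: funpow_mult)
  have mod: "(w ^^ k) f = (w ^^ (k mod m)) f" for k f
  proof -
    have "(w ^^ (m * j)) f = f" for j f
      by (induction j) (simp_all add: funpow_add pow)
    then have "(w ^^ (k mod m + m * (k div m))) f = (w ^^ (k mod m)) f"
      by (simp only: funpow_add o_apply)
    then show ?thesis by simp
  qed
  have "(w ^^ k) b \<in> (\<lambda>k. (w ^^ k) b) ` {..<m}" for k
    using mod[of k b] m by (intro image_eqI[of _ _ "k mod m"]) auto
  then show ?thesis
    unfolding group_orbit_def cyclic_group_gen_def inv_pow by auto
qed

lemma simple_lie_algebra_roots:
  assumes simple: "simple_lie_algebra sc br" and cartan: "cartan_subalgebra sc br H"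
    and a: "a \<in> lie_roots sc br H"
  shows "b \<in> lie_roots sc br H \<Longrightarrow> root_reflection sc br H a b \<in> lie_roots sc br H"
    and "(\<lambda>x. of_nat k * a x) \<in> lie_roots sc br H \<Longrightarrow> k = 1"
proof -
  interpret complex_lie_algebra sc br using simple by (simp add: simple_lie_algebra_def)
  obtain B wt where B: "independent B" "span B = UNIV"
    "\<forall>b\<in>B. wt b \<in> dual_space sc H \<and> b \<in> root_space sc br H (wt b)"
    using cartan by (rule weight_basis_exists)
  interpret simple_weight_basis sc br H B wt
    by unfold_locales (use simple cartan B in auto)
  show "b \<in> lie_roots sc br H \<Longrightarrow> root_reflection sc br H a b \<in> lie_roots sc br H"
    by (rule root_reflection_root[OF a])
  show "(\<lambda>x. of_nat k * a x) \<in> lie_roots sc br H \<Longrightarrow> k = 1"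
    by (rule root_multiple[OF a])
qed

lemma reflection_product_foldr:
  "reflection_product sc br H \<alpha> J = foldr (\<lambda>i. root_reflection sc br H (\<alpha> i)) (sorted_list_of_set J)"
proof -
  have "foldr (\<circ>) (map g xs) id = foldr g xs" for g :: "nat \<Rightarrow> 'b \<Rightarrow> 'b" and xs
    by (induction xs) auto
  then show ?thesis by (simp add: reflection_product_def)
qed

theorem theorem1p8:
  fixes sc :: "complex \<Rightarrow> 'g::ab_group_add \<Rightarrow> 'g"
    and br :: "'g \<Rightarrow> 'g \<Rightarrow> 'g"
    and H :: "'g set"
    and l h :: nat
    and X :: dynkin_type
    and \<alpha> \<beta> :: "nat \<Rightarrow> 'g \<Rightarrow> complex"
    and \<psi> :: "'g \<Rightarrow> complex"
    and I1 I2 :: "nat set"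
    and \<sigma> :: "('g \<Rightarrow> complex) \<Rightarrow> ('g \<Rightarrow> complex)"
    and Z :: "(('g \<Rightarrow> complex) \<Rightarrow> ('g \<Rightarrow> complex)) set"
  assumes "simple_lie_algebra sc br"
    and "cartan_subalgebra sc br H"
    and "vector_space.dim sc H = l"
    and "simple_roots sc br H l \<alpha>"
    and "has_dynkin_type sc br H l \<alpha> X"
    and "(X = TypeA l \<and> odd l) \<or> (X = TypeD l \<and> 4 \<le> l) \<or> X = TypeE 6 \<or> X = TypeE 7 \<or> X = TypeE 8"
    and "highest_root sc br H l \<alpha> \<psi>"
    and "admissible_partition sc br H l \<alpha> \<psi> I1 I2"
    and "\<sigma> = coxeter_element sc br H \<alpha> I1 I2"
    and "h = coxeter_number sc H \<sigma>"
    and "Z = cyclic_group_gen \<sigma>"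
    and "\<And>i. \<beta> i = (if i \<in> I1 then \<alpha> i else - \<alpha> i)"
  shows "(\<forall>i\<in>{1..l}. card (group_orbit Z (\<beta> i)) = h) \<and>
    lie_roots sc br H = (\<Union>i\<in>{1..l}. group_orbit Z (\<beta> i)) \<and>
    (\<forall>i\<in>{1..l}. \<forall>j\<in>{1..l}. i \<noteq> j \<longrightarrow> group_orbit Z (\<beta> i) \<inter> group_orbit Z (\<beta> j) = {})"
proof -
  let ?R = "lie_roots sc br H"
  define H' where "H' i = coroot sc br H (\<alpha> i)" for i
  have part: "I1 \<union> I2 = {1..l}" "I1 \<inter> I2 = {}"
    and orth: "\<And>i j. i \<in> I1 \<Longrightarrow> j \<in> I1 \<Longrightarrow> i \<noteq> j \<Longrightarrow> \<alpha> j (H' i) = 0"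
      "\<And>i j. i \<in> I2 \<Longrightarrow> j \<in> I2 \<Longrightarrow> i \<noteq> j \<Longrightarrow> \<alpha> j (H' i) = 0"
    using assms(8) by (auto simp: admissible_partition_def orthogonal_roots_def H'_def)
  have simple: "\<And>i. i \<in> {1..l} \<Longrightarrow> \<alpha> i \<in> ?R"
    and indep: "\<And>c. (\<And>x. (\<Sum>i = 1..l. c i * \<alpha> i x) = 0) \<Longrightarrow> \<forall>i\<in>{1..l}. c i = 0"
    and sign: "\<And>b. b \<in> ?R \<Longrightarrow> \<exists>n :: nat \<Rightarrow> nat.
        b = (\<lambda>x. \<Sum>i = 1..l. of_nat (n i) * \<alpha> i x) \<or>
        b = (\<lambda>x. - (\<Sum>i = 1..l. of_nat (n i) * \<alpha> i x))"
    using assms(4) unfolding simple_roots_def by blast+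
  obtain p where l: "l = dynkin_rank X" and p: "bij_betw p {1..l} {1..l}"
    and C: "\<And>i j. i \<in> {1..l} \<Longrightarrow> j \<in> {1..l} \<Longrightarrow>
      \<alpha> (p j) (H' (p i)) = of_int (cartan_matrix X i j)"
    using assms(5) unfolding has_dynkin_type_def H'_def by blast
  \<comment> \<open>\<open>p'\<close> translates into Bourbaki's numbering, in which the Cartan
    matrix and the vector \<open>v\<close> are given.\<close>
  define p' where "p' = inv_into {1..l} p"
  have p': "p' i \<in> {1..l}" "p (p' i) = i" if "i \<in> {1..l}" for i
    using p that bij_betw_inv_into_right[OF p] bij_betwE[OF bij_betw_inv_into[OF p]]
    by (auto simp: p'_def)
  have p'_inj: "p' i = p' j \<longleftrightarrow> i = j" if "i \<in> {1..l}" "j \<in> {1..l}" for i j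
    using p'(2) that by metis
  \<comment> \<open>The value zero outside the index range makes \<open>A\<close> symmetric for all
    pairs of numbers.\<close>
  define A where "A i j = (if i \<in> {1..l} \<and> j \<in> {1..l}
    then 2 * of_bool (i = j) - cartan_matrix X (p' i) (p' j) else 0)" for i j
  have sym: "cartan_matrix X i j = cartan_matrix X j i" for i j
    by (auto simp: cartan_matrix_def)
  have vals: "\<alpha> j (H' i) = of_int (2 * of_bool (i = j) - A i j)" if "i \<in> {1..l}" "j \<in> {1..l}" for i j
    using C[OF p'(1)[OF that(1)] p'(1)[OF that(2)]] p'(2) that by (simp add: A_def)
  have A_zero: "A i j = 0" if "i \<in> {1..l}" "j \<in> {1..l}" "i \<noteq> j \<Longrightarrow> \<alpha> j (H' i) = 0" for i j
    using vals[OF that(1,2)] that(3) by (cases "i = j") (simp_all add: A_def cartan_matrix_def)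
  obtain m v where mv: "perron_pair X m v" using perron_pair_exists[OF assms(6)] by blast
  have loop: "\<not> dynkin_edge X i i" for i using assms(6) by auto
  have perron: "(\<Sum>j = 1..l. of_int (A i j) * v (p' j)) = 2 * cos (pi / m) * v (p' i)"
    if i: "i \<in> {1..l}" for i
  proof -
    have "(\<Sum>j = 1..l. of_int (A i j) * v (p' j))
        = (\<Sum>j = 1..l. of_int (2 * of_bool (p' i = p' j) - cartan_matrix X (p' i) (p' j)) * v (p' j))"
      using i by (intro sum.cong refl) (simp add: A_def p'_inj)
    also have "\<dots> = (\<Sum>j = 1..l. of_int (2 * of_bool (p' i = j) - cartan_matrix X (p' i) j) * v j)"
      using bij_betw_inv_into[OF p] unfolding p'_def
      by (rule sum.reindex_bij_betw[where g = "\<lambda>j. of_int (2 * of_bool (inv_into {1..l} p i = j)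
            - cartan_matrix X (inv_into {1..l} p i) j) * v j"])
    also have "\<dots> = 2 * cos (pi / m) * v (p' i)"
      using perron_pair_cartan[OF mv _ loop] p'(1)[OF i] by (simp only: l)
    finally show ?thesis .
  qed
  have finite: "finite I1" "finite I2" using part(1) by (metis finite_Un finite_atLeastAtMost)+
  interpret reflection_graph I1 I2 A "\<lambda>i. v (p' i)" m \<alpha> H' ?R
  proof
    show "finite I1" "finite I2" "I1 \<inter> I2 = {}" by (fact finite part(2))+
    show "A i j = A j i" for i j by (auto simp: A_def sym)
    show "A i j = 0" if "i \<in> I1" "j \<in> I1" for i j
      using that part(1) orth(1)[OF that] by (intro A_zero) auto
    show "A i j = 0" if "i \<in> I2" "j \<in> I2" for i j
      using that part(1) orth(2)[OF that] by (intro A_zero) auto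
    show "v (p' i) > 0" if "i \<in> I1 \<union> I2" for i
      using mv p'(1) that unfolding perron_pair_def part(1) l by blast
    show "(\<Sum>j\<in>I1 \<union> I2. of_int (A i j) * v (p' j)) = 2 * cos (pi / m) * v (p' i)"
      if "i \<in> I1 \<union> I2" for i
      using perron that unfolding part(1) by blast
    show "m \<ge> 2" using mv by (simp add: perron_pair_def)
    show "\<alpha> j (H' i) = of_int (2 * of_bool (i = j) - A i j)" if "i \<in> I1 \<union> I2" "j \<in> I1 \<union> I2" for i j
      using vals that unfolding part(1) by blast
    show "n i = 0" if "\<And>y. (\<Sum>i\<in>I1 \<union> I2. of_int (n i) * \<alpha> i y) = 0" "i \<in> I1 \<union> I2" for n :: "nat \<Rightarrow> int" and i
      using indep[of "\<lambda>i. of_int (n i)"] that unfolding part(1) by simp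
    show "\<alpha> i \<in> ?R" if "i \<in> I1 \<union> I2" for i using simple that unfolding part(1) by blast
    show "(\<lambda>y. f y - f (H' i) * \<alpha> i y) \<in> ?R" if "i \<in> I1 \<union> I2" "f \<in> ?R" for i f
      using simple_lie_algebra_roots(1)[OF assms(1,2) simple that(2)] that(1)
      unfolding part(1) root_reflection_def H'_def by blast
    show "\<exists>n :: nat \<Rightarrow> nat. f = (\<lambda>y. \<Sum>i\<in>I1 \<union> I2. of_nat (n i) * \<alpha> i y) \<or>
      f = (\<lambda>y. - (\<Sum>i\<in>I1 \<union> I2. of_nat (n i) * \<alpha> i y))" if "f \<in> ?R" for f
      using sign[OF that] unfolding part(1) .
    show "k = 1" if "i \<in> I1 \<union> I2" "(\<lambda>y. of_nat k * \<alpha> i y) \<in> ?R" for i k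
      using simple_lie_algebra_roots(2)[OF assms(1,2) simple that(2)] that(1) unfolding part(1) by blast
    show "(\<lambda>_. 0) \<notin> ?R" by (simp add: lie_roots_def)
  qed
  have S_eq: "S = (\<lambda>i. root_reflection sc br H (\<alpha> i))"
    by (simp add: fun_eq_iff S_def root_reflection_def H'_def)
  have w: "\<sigma> = foldr S (sorted_list_of_set I2) \<circ> foldr S (sorted_list_of_set I1)"
    by (simp add: assms(9) coxeter_element_def reflection_product_foldr S_eq)
  have lists: "set (sorted_list_of_set I1) = I1" "distinct (sorted_list_of_set I1)"
    "set (sorted_list_of_set I2) = I2" "distinct (sorted_list_of_set I2)"
    using finite by simp_all
  note facts = lists w assms(12)
  have m: "m > 0" using mv by (simp add: perron_pair_def)
  have orbit: "group_orbit Z f = (\<lambda>k. (\<sigma> ^^ k) f) ` {..<m}" for f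
    unfolding assms(11) using coxeter_pow_m[OF facts] m by (rule group_orbit_cyclic)
  \<comment> \<open>The rank is positive, so there is a root, and its orbit shows that no smaller
    positive power of \<open>\<sigma>\<close> is the identity.\<close>
  have "1 \<in> {1..l}" using assms(6) l odd_pos[of l] by auto
  then have root1: "\<beta> 1 \<in> ?R" using b_\<Delta>[OF facts] unfolding part(1) by blast
  have h: "h = m"
    unfolding assms(10) coxeter_number_def
  proof (rule Least_equality)
    show "0 < m \<and> (\<forall>f\<in>dual_space sc H. (\<sigma> ^^ m) f = f)" using m coxeter_pow_m[OF facts] by blast
    fix k assume k: "0 < k \<and> (\<forall>f\<in>dual_space sc H. (\<sigma> ^^ k) f = f)"
    then have "(\<sigma> ^^ k) (\<beta> 1) = \<beta> 1" using root1 by (simp add: lie_roots_def)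
    then show "m \<le> k" using coxeter_pow_fixed[OF facts root1] k by (intro dvd_imp_le) auto
  qed
  \<comment> \<open>With natural exponents, \<open>m - k\<close> serves as the inverse of the
    exponent \<open>k\<close>.\<close>
  have cancel: "(\<sigma> ^^ ((m - k) + k')) f = g" if "(\<sigma> ^^ k) g = (\<sigma> ^^ k') f" "k < m" for k k' f g
  proof -
    have "(\<sigma> ^^ ((m - k) + k')) f = (\<sigma> ^^ ((m - k) + k)) g" by (simp only: funpow_add o_apply that(1))
    then show ?thesis using that(2) coxeter_pow_m[OF facts] by simp
  qed
  have "card (group_orbit Z (\<beta> i)) = h" if i: "i \<in> {1..l}" for i
  proof -
    have R: "\<beta> i \<in> ?R" using i b_\<Delta>[OF facts] unfolding part(1) by blast
    have "inj_on (\<lambda>k. (\<sigma> ^^ k) (\<beta> i)) {..<m}"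
    proof (rule linorder_inj_onI)
      fix k k' assume k: "k < k'" "k \<in> {..<m}" "k' \<in> {..<m}"
      show "(\<sigma> ^^ k) (\<beta> i) \<noteq> (\<sigma> ^^ k') (\<beta> i)"
      proof
        assume "(\<sigma> ^^ k) (\<beta> i) = (\<sigma> ^^ k') (\<beta> i)"
        then have "m dvd (m - k) + k'" using cancel k by (intro coxeter_pow_fixed[OF facts R]) auto
        moreover have "(m - k) + k' = m + (k' - k)" using k by auto
        ultimately have "m dvd k' - k" by simp
        then show False using k by (auto dest: dvd_imp_le)
      qed
    qed auto
    then show ?thesis unfolding orbit h by (simp add: card_image)
  qed
  moreover have "?R = (\<Union>i\<in>{1..l}. group_orbit Z (\<beta> i))"
  proof
    show "(\<Union>i\<in>{1..l}. group_orbit Z (\<beta> i)) \<subseteq> ?R"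
      unfolding orbit using coxeter_pow_\<Delta>[OF facts] b_\<Delta>[OF facts] unfolding part(1) by blast
    show "?R \<subseteq> (\<Union>i\<in>{1..l}. group_orbit Z (\<beta> i))"
    proof
      fix f assume "f \<in> ?R"
      then obtain k i where ki: "i \<in> {1..l}" "(\<sigma> ^^ k) f = \<beta> i"
        using coxeter_orbit_reaches[OF facts] unfolding part(1) by blast
      have "(\<sigma> ^^ (m * n)) f = f" for n
        by (induction n) (simp_all add: funpow_add coxeter_pow_m[OF facts])
      \<comment> \<open>Here \<open>k\<close> may exceed \<open>m\<close>, so the inverse exponent
        is taken as \<open>m * k - k\<close>.\<close>
      moreover have "(\<sigma> ^^ ((m * k - k) + k)) f = (\<sigma> ^^ (m * k - k)) (\<beta> i)"
        by (simp only: funpow_add o_apply ki(2))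
      moreover have "(m * k - k) + k = m * k" using m by simp
      ultimately have "f = (\<sigma> ^^ (m * k - k)) (\<beta> i)" by metis
      then have "f \<in> group_orbit Z (\<beta> i)"
        by (auto simp: assms(11) group_orbit_def cyclic_group_gen_def)
      then show "f \<in> (\<Union>i\<in>{1..l}. group_orbit Z (\<beta> i))" using ki(1) by blast
    qed
  qed
  moreover have "group_orbit Z (\<beta> i) \<inter> group_orbit Z (\<beta> j) = {}"
    if "i \<in> {1..l}" "j \<in> {1..l}" "i \<noteq> j" for i j
  proof (rule ccontr)
    assume "group_orbit Z (\<beta> i) \<inter> group_orbit Z (\<beta> j) \<noteq> {}"
    then obtain g where "g \<in> group_orbit Z (\<beta> i)" "g \<in> group_orbit Z (\<beta> j)" by blast
    then obtain k k' where "g = (\<sigma> ^^ k') (\<beta> i)" "g = (\<sigma> ^^ k) (\<beta> j)" and k: "k < m"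
      unfolding orbit by blast
    then have "(\<sigma> ^^ k) (\<beta> j) = (\<sigma> ^^ k') (\<beta> i)" by simp
    from cancel[OF this k] have "i = j"
      using that(1,2) by (intro coxeter_orbits_disjoint[OF facts]) (simp_all only: part(1))
    then show False using that(3) by simp
  qed
  ultimately show ?thesis by blast
qed

end
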